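(* Let $G$ be a graph, potentially with loops, whose vertices with loops are $z_1,\dots,z_r$, and assume $e_1=\{x_1,y_1\},\dots,e_t=\{x_t,y_t\}$ are disjoint regular edges of $G$ such that for each $2\le i\le t$ either $$N_G(x_i)\cap\{x_1,y_1,\dots,x_{i-1},y_{i-1},z_1,\dots,z_r\}=\emptyset$$ or $$N_G(y_i)\cap\{x_1,y_1,\dots,x_{i-1},y_{i-1},z_1,\dots,z_r\}=\emptyset.$$ Then $I(G_{e_1,\dots,e_t})$ and $I(G^{e_1,\dots,e_t})$ both have the same $h$-vector as $I=I(G)$, and the Hilbert series of $R/I$ is equal to the Hilbert series of $R/I(G^{e_1,\dots,e_t})$.
   Context: All graphs are finite. A graph $G$ potentially with loops has a loop at $x\in V(G)$ if $\{x,x\}\in E(G)$. For a field $k$, the edge ideal of a graph $H$ is $I(H)=\langle uv \mid \{u,v\}\in E(H)\rangle$ in the polynomial ring $k[V(H)]$ over $k$ with variables the vertices of $H$ (a loop at $x$ contributes $x^2$); $R=k[V(G)]$. The neighbor set is $N_G(v)=\{u\mid \{u,v\}\in E(G)\}$. An edge $\{a,b\}$ is identified with the monomial $ab$. Regular edge: an edge $\{a,b\}$ of $G$ is regular if for every associated prime $Q$ of $R/I(G)$ one has $ab\notin Q^2$; that is, precisely one of $a,b$ is in $Q$. For an edge $e=\{x,y\}\in E(G)$ with $x\neq y$ (with the vertices labelled in this order): $G_e$ is the graph with $V(G_e)=V(G)\setminus\{y\}$ and edges: (i) $\{a,b\}\in E(G_e)$ if $\{a,b\}\in E(G)$ and $a,b\neq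 y$; (ii) $\{a,x\}\in E(G_e)$ if $\{a,y\}\in E(G)$ (with $a\in V(G_e)$; in particular $G_e$ has a loop at $x$). $G^e$ is the graph with $V(G^e)=V(G)$ and edges: (i) $\{a,b\}\in E(G^e)$ if $\{a,b\}\in E(G)$ and $a,b\neq y$; (ii) $\{a,x\}\in E(G^e)$ if $\{a,y\}\in E(G)$ and $a\neq x$; (iii) $\{x,y\}\in E(G^e)$. Iterates: $G_{e_1,e_2}=(G_{e_1})_{e_2}$, $G^{e_1,e_2}=(G^{e_1})^{e_2}$, and similarly for longer lists. Hilbert series and $h$-vector: for a homogeneous ideal $J$ in a standard graded polynomial ring $S$ over $k$, $HS_{S/J}=\sum_{s\ge0}\dim_k (S/J)_s t^s=\frac{h_0+h_1t+h_2t^2+\cdots}{(1-t)^d}$ with $d=\dim(S/J)$ and numerator a polynomial; the $h$-vector of $J$ (or of $S/J$) is the vector of coefficients $(h_0,h_1,\dots)$ of the numerator. Equality of $h$-vectors means equality of numerator polynomials (trailing zeros are ignored). *)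

theory Defs
  imports
    "HOL-Library.Poly_Mapping"
    "HOL-Library.Extended_Nat"
    "HOL-Computational_Algebra.Polynomial_FPS"
    "HOL-Algebra.QuotRing"
    "HOL-Algebra.Ideal_Product"
    "HOL-Algebra.Embedded_Algebras"
begin

section \<open>Graphs potentially with loops\<close>

record 'v loop_graph =
  verts :: "'v set"
  edges :: "'v set set"

text \<open>A loop at \<open>x\<close> is the singleton edge \<open>{x, x} = {x}\<close>.\<close>

definition finite_loop_graph :: "'v loop_graph \<Rightarrow> bool" where
  "finite_loop_graph G \<longleftrightarrow>
     finite (verts G) \<and> (\<forall>e\<in>edges G. \<exists>a\<in>verts G. \<exists>b\<in>verts G. e = {a, b})"

definition loop_verts :: "'v loop_graph \<Rightarrow> 'v set" where
  "loop_verts G = {z \<in> verts G. {z, z} \<in> edges G}"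

definition nbrs :: "'v loop_graph \<Rightarrow> 'v \<Rightarrow> 'v set" where
  "nbrs G v = {u. {u, v} \<in> edges G}"

text \<open>\<open>edge_lower G x y\<close> is \<open>G\<^sub>e\<close> and \<open>edge_upper G x y\<close> is \<open>G\<^sup>e\<close> for the edge \<open>e = {x, y}\<close>, labelled
  in this order.\<close>

definition edge_lower :: "'v loop_graph \<Rightarrow> 'v \<Rightarrow> 'v \<Rightarrow> 'v loop_graph" where
  "edge_lower G x y =
     \<lparr> verts = verts G - {y},
       edges = {{a, b} | a b. {a, b} \<in> edges G \<and> a \<noteq> y \<and> b \<noteq> y}
             \<union> {{a, x} | a. a \<in> verts G - {y} \<and> {a, y} \<in> edges G} \<rparr>"

definition edge_upper :: "'v loop_graph \<Rightarrow> 'v \<Rightarrow> 'v \<Rightarrow> 'v loop_graph" where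
  "edge_upper G x y =
     \<lparr> verts = verts G,
       edges = {{a, b} | a b. {a, b} \<in> edges G \<and> a \<noteq> y \<and> b \<noteq> y}
             \<union> {{a, x} | a. {a, y} \<in> edges G \<and> a \<noteq> x}
             \<union> {{x, y}} \<rparr>"

text \<open>Iterates along the edges \<open>{x 1, y 1}, \<dots>, {x t, y t}\<close>, the edge with index 1 first.\<close>

definition iter_lower :: "'v loop_graph \<Rightarrow> (nat \<Rightarrow> 'v) \<Rightarrow> (nat \<Rightarrow> 'v) \<Rightarrow> nat \<Rightarrow> 'v loop_graph" where
  "iter_lower G x y t = fold (\<lambda>i H. edge_lower H (x i) (y i)) [1..<Suc t] G"

definition iter_upper :: "'v loop_graph \<Rightarrow> (nat \<Rightarrow> 'v) \<Rightarrow> (nat \<Rightarrow> 'v) \<Rightarrow> nat \<Rightarrow> 'v loop_graph" where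
  "iter_upper G x y t = fold (\<lambda>i H. edge_upper H (x i) (y i)) [1..<Suc t] G"


section \<open>Polynomial rings and edge ideals\<close>

text \<open>Monomials are finitely supported exponent functions; multiplication of polynomials is the
  convolution product of \<open>HOL-Library.Poly_Mapping\<close>.\<close>

type_synonym ('v, 'k) mpoly = "('v \<Rightarrow>\<^sub>0 nat) \<Rightarrow>\<^sub>0 'k"

definition var :: "'v \<Rightarrow> ('v, 'k::field) mpoly" where
  "var v = Poly_Mapping.single (Poly_Mapping.single v 1) 1"

definition const :: "'k \<Rightarrow> ('v, 'k::field) mpoly" where
  "const c = Poly_Mapping.single 0 c"

definition monom_deg :: "('v \<Rightarrow>\<^sub>0 nat) \<Rightarrow> nat" where
  "monom_deg m = (\<Sum>v\<in>Poly_Mapping.keys m. Poly_Mapping.lookup m v)"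

text \<open>\<open>poly_ring V\<close> is \<open>k[V]\<close>, with variables only those in \<open>V\<close>.\<close>

definition poly_ring :: "'v set \<Rightarrow> ('v, 'k::field) mpoly ring" where
  "poly_ring V =
     \<lparr> carrier = {p. \<forall>m\<in>Poly_Mapping.keys p. Poly_Mapping.keys m \<subseteq> V},
       mult = (*), one = 1, zero = 0, add = (+) \<rparr>"

lemma cring_poly_ring: "cring (poly_ring V :: ('v, 'k::field) mpoly ring)"
proof -
  define C where "C = carrier (poly_ring V :: ('v, 'k) mpoly ring)"
  have C_iff: "p \<in> C \<longleftrightarrow> (\<forall>m\<in>Poly_Mapping.keys p. Poly_Mapping.keys m \<subseteq> V)" for p
    by (simp add: C_def poly_ring_def)
  have sel: "carrier (poly_ring V :: ('v, 'k) mpoly ring) = C"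
    "add (poly_ring V :: ('v, 'k) mpoly ring) = (+)"
    "mult (poly_ring V :: ('v, 'k) mpoly ring) = (*)"
    "zero (poly_ring V :: ('v, 'k) mpoly ring) = 0"
    "one (poly_ring V :: ('v, 'k) mpoly ring) = 1"
    by (simp_all add: C_def poly_ring_def)
  have add: "p + q \<in> C" if "p \<in> C" "q \<in> C" for p q
    using that Poly_Mapping.keys_add[of p q] unfolding C_iff by blast
  have mult: "p * q \<in> C" if "p \<in> C" "q \<in> C" for p q
    unfolding C_iff
  proof
    fix m assume "m \<in> Poly_Mapping.keys (p * q)"
    then obtain a b where "m = a + b" "a \<in> Poly_Mapping.keys p" "b \<in> Poly_Mapping.keys q"
      using Poly_Mapping.keys_mult[of p q] by blast
    then show "Poly_Mapping.keys m \<subseteq> V"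
      using that Poly_Mapping.keys_add[of a b] unfolding C_iff by blast
  qed
  have uminus: "- p \<in> C" if "p \<in> C" for p
    using that unfolding C_iff by (simp add: Poly_Mapping.in_keys_iff)
  have zero: "0 \<in> C" and one: "1 \<in> C"
    by (simp_all add: C_iff)
  show ?thesis
  proof (rule cringI)
    show "abelian_group (poly_ring V :: ('v, 'k) mpoly ring)"
    proof (rule abelian_groupI, unfold sel)
      fix p assume "p \<in> C"
      then show "\<exists>q\<in>C. q + p = 0"
        using uminus[of p] by (intro bexI[of _ "- p"]) simp_all
    qed (simp_all add: add zero add.assoc add.commute)
    show "comm_monoid (poly_ring V :: ('v, 'k) mpoly ring)"
      by (rule comm_monoidI; unfold sel; simp add: mult one mult.assoc; simp add: mult.commute)
  qed (simp_all add: sel distrib_right)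
qed

definition edge_ideal :: "'v loop_graph \<Rightarrow> ('v, 'k::field) mpoly set" where
  "edge_ideal H = Idl\<^bsub>poly_ring (verts H)\<^esub> {var u * var v | u v. {u, v} \<in> edges H}"


section \<open>Associated primes and regular edges\<close>

text \<open>\<open>Q\<close> is a prime of \<open>R\<close> that is the annihilator of an element of the \<open>R\<close>-module \<open>R/I\<close>.\<close>

definition associated_prime :: "('a, 'b) ring_scheme \<Rightarrow> 'a set \<Rightarrow> 'a set \<Rightarrow> bool" where
  "associated_prime R I Q \<longleftrightarrow>
     primeideal Q R \<and>
     (\<exists>u\<in>carrier (R Quot I).
        Q = {g \<in> carrier R. (I +>\<^bsub>R\<^esub> g) \<otimes>\<^bsub>R Quot I\<^esub> u = \<zero>\<^bsub>R Quot I\<^esub>})"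

text \<open>The first argument fixes the coefficient field.\<close>

definition regular_edge :: "'k::field itself \<Rightarrow> 'v loop_graph \<Rightarrow> 'v \<Rightarrow> 'v \<Rightarrow> bool" where
  "regular_edge _ G a b \<longleftrightarrow>
     {a, b} \<in> edges G \<and>
     (\<forall>Q :: ('v, 'k) mpoly set.
        associated_prime (poly_ring (verts G)) (edge_ideal G) Q \<longrightarrow>
        var a * var b \<notin> ideal_prod (poly_ring (verts G)) Q Q)"


section \<open>Hilbert series, Krull dimension and h-vectors\<close>

text \<open>For a homogeneous ideal \<open>J\<close> of \<open>S = k[V]\<close>, \<open>quot_comp V J s\<close> is the graded component
  \<open>(S/J)\<^sub>s\<close>: the classes of the homogeneous polynomials of degree \<open>s\<close>. The copy of \<open>k\<close> inside \<open>S/J\<close>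
  is \<open>quot_scalars V J\<close>.\<close>

definition quot_comp :: "'v set \<Rightarrow> ('v, 'k::field) mpoly set \<Rightarrow> nat \<Rightarrow> ('v, 'k) mpoly set set" where
  "quot_comp V J s =
     {J +>\<^bsub>poly_ring V\<^esub> p | p. p \<in> carrier (poly_ring V) \<and> (\<forall>m\<in>Poly_Mapping.keys p. monom_deg m = s)}"

definition quot_scalars :: "'v set \<Rightarrow> ('v, 'k::field) mpoly set \<Rightarrow> ('v, 'k) mpoly set set" where
  "quot_scalars V J = {J +>\<^bsub>poly_ring V\<^esub> const c | c. True}"

definition hilbert_series :: "'v set \<Rightarrow> ('v, 'k::field) mpoly set \<Rightarrow> int fps" where
  "hilbert_series V J =
     Abs_fps (\<lambda>s. int (ring.dim (poly_ring V Quot J) (quot_scalars V J) (quot_comp V J s)))"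

definition krull_dim :: "('a, 'b) ring_scheme \<Rightarrow> enat" where
  "krull_dim R =
     Sup {enat n | n. \<exists>P :: nat \<Rightarrow> 'a set.
            (\<forall>i\<le>n. primeideal (P i) R) \<and> (\<forall>i<n. P i \<subset> P (Suc i))}"

text \<open>\<open>h\<close> is the numerator of the Hilbert series of \<open>k[V]/J\<close> over \<open>(1 - t)^d\<close> with
  \<open>d = dim k[V]/J\<close>; its coefficients form the h-vector of \<open>J\<close>.\<close>

definition is_h_polynomial :: "'v set \<Rightarrow> ('v, 'k::field) mpoly set \<Rightarrow> int poly \<Rightarrow> bool" where
  "is_h_polynomial V J h \<longleftrightarrow>
     (\<exists>d. krull_dim (poly_ring V Quot J) = enat d \<and>
          hilbert_series V J * (1 - fps_X) ^ d = fps_of_poly h)"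

lemma is_h_polynomial_unique:
  assumes "is_h_polynomial V J h" and "is_h_polynomial V J h'"
  shows "h = h'"
  using assms unfolding is_h_polynomial_def by (metis enat.inject fps_of_poly_eq_iff)

text \<open>Equality of h-vectors includes the existence of the (unique) numerator polynomial.\<close>

definition same_h_vector ::
  "'v set \<Rightarrow> ('v, 'k::field) mpoly set \<Rightarrow> 'v set \<Rightarrow> ('v, 'k) mpoly set \<Rightarrow> bool" where
  "same_h_vector V J W L \<longleftrightarrow> (\<exists>h. is_h_polynomial V J h \<and> is_h_polynomial W L h)"

end

theory Submission
  imports Defs
begin

text \<open>Both contractions are governed by the monomials outside the edge ideal. A monomial survives in
\<open>k[V]/I(H)\<close> when its support contains no edge between distinct vertices and no loop vertex has
exponent above 1; the surviving monomials form a basis, so the Hilbert series is a count of them and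
depends on the graph alone.

Regularity of an edge \<open>{x, y}\<close> has a purely combinatorial consequence: every neighbour \<open>a\<close> of \<open>x\<close> and
every neighbour \<open>b\<close> of \<open>y\<close> are distinct and adjacent (\<open>regular_edge_imp_regular_pair\<close>). Otherwise the
squarefree product of \<open>a\<close> and \<open>b\<close> would be a surviving monomial killed by both variables \<open>x\<close> and
\<open>y\<close>, and an associated prime above its annihilator would contain \<open>x\<close> and \<open>y\<close>. Consequently a
support \<open>B\<close> without \<open>x\<close> and \<open>y\<close> can be extended by \<open>x\<close> or by \<open>y\<close>, possibly by either, but never by
both at once. Grouping the supports by their part outside \<open>{x, y}\<close>, with \<open>q = t/(1 - t)\<close> the series of
the positive powers of one variable, the factor contributed by \<open>x\<close> and \<open>y\<close> is

  \<^item> in \<open>H\<close>: \<open>1 + 2 q\<close> if both extensions are possible and \<open>1 + q\<close> if only one is;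

  \<^item> in the upper contraction: the same, since there \<open>y\<close> extends every \<open>B\<close> and \<open>x\<close> extends those
    that both \<open>x\<close> and \<open>y\<close> extend in \<open>H\<close>;

  \<^item> in the lower contraction, where \<open>x\<close> has a loop: \<open>1 + t\<close> and \<open>1\<close>, which is \<open>1 - t\<close> times the
    factor in \<open>H\<close>.

So the upper contraction keeps the Hilbert series and the lower one multiplies it by \<open>1 - t\<close>
(\<open>hilbert_series_regular_edge\<close>).

The h-vector also involves the Krull dimension, which is the largest size of an independent set
without loops (\<open>krull_dim_edge_ideal\<close>). The bound from below is a chain of primes generated by
variables. For the bound from above, choosing \<open>f\<^sub>i\<close> in the \<open>i\<close>-th prime of a chain but not in the one
before makes \<open>f\<^sub>1, \<dots>, f\<^sub>n\<close> algebraically independent modulo the smallest prime; the \<open>(s + 1)\<^sup>n\<close> products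
of their powers with exponents at most \<open>s\<close> have degree at most linear in \<open>s\<close>, whereas with \<open>d\<close> the
independence number only \<open>O(s\<^sup>d)\<close> monomials up to that degree survive, so that \<open>n \<le> d\<close>. The independence
number drops by one under lower contraction and is kept by upper contraction
(\<open>indep_number_regular_edge\<close>), which matches the change of the series.

Finally, the adjacency property of an edge passes to a contracted graph as long as the neighbours of
one of its ends avoid the contracted edge (\<open>regular_pair_contracts\<close>), and those neighbours do not
change, so the hypothesis on the later edges survives and the argument can be iterated.\<close>

section \<open>Monomial ideals and edge ideals\<close>

text \<open>For a set \<open>B\<close> of monomials that contains all multiples of its elements, this is the ideal generated by
the monomials of \<open>k[V]\<close> in \<open>B\<close>. Edge ideals and the primes generated by variables are both of this form.\<close>

definition monom_ideal :: "'v set \<Rightarrow> ('v \<Rightarrow>\<^sub>0 nat) set \<Rightarrow> ('v, 'k::field) mpoly set" where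
  "monom_ideal V B = {p \<in> carrier (poly_ring V). Poly_Mapping.keys p \<subseteq> B}"

abbreviation monomial :: "('v \<Rightarrow>\<^sub>0 nat) \<Rightarrow> ('v, 'k::field) mpoly" where
  "monomial m \<equiv> Poly_Mapping.single m 1"

lemma poly_ring_simps [simp]:
  "mult (poly_ring V :: ('v, 'k::field) mpoly ring) = (*)"
  "one (poly_ring V :: ('v, 'k) mpoly ring) = 1"
  "zero (poly_ring V :: ('v, 'k) mpoly ring) = 0"
  "add (poly_ring V :: ('v, 'k) mpoly ring) = (+)"
  by (simp_all add: poly_ring_def)

lemma poly_ring_carrier_iff:
  "p \<in> carrier (poly_ring V) \<longleftrightarrow> (\<forall>m\<in>Poly_Mapping.keys p. Poly_Mapping.keys m \<subseteq> V)"
  by (simp add: poly_ring_def)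

lemma monom_in_carrier: "Poly_Mapping.keys m \<subseteq> V \<Longrightarrow> monomial m \<in> carrier (poly_ring V)"
  by (simp add: poly_ring_carrier_iff)

lemma const_in_carrier [simp]: "const c \<in> carrier (poly_ring V)"
  by (simp add: poly_ring_carrier_iff const_def)

lemma poly_ring_closed:
  fixes p q :: "('v, 'k::field) mpoly"
  assumes "p \<in> carrier (poly_ring V)" "q \<in> carrier (poly_ring V)"
  shows "p + q \<in> carrier (poly_ring V)" "p * q \<in> carrier (poly_ring V)"
    "p - q \<in> carrier (poly_ring V)"
proof -
  interpret cring "poly_ring V :: ('v, 'k) mpoly ring" by (rule cring_poly_ring)
  show "p + q \<in> carrier (poly_ring V)" "p * q \<in> carrier (poly_ring V)"
    using add.m_closed[OF assms] m_closed[OF assms] by simp_all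
  show "p - q \<in> carrier (poly_ring V)"
    using assms by (auto simp: poly_ring_carrier_iff dest!: subsetD[OF keys_diff])
qed

lemma poly_ring_uminus_closed: "p \<in> carrier (poly_ring V) \<Longrightarrow> - p \<in> carrier (poly_ring V)"
  by (simp add: poly_ring_carrier_iff)

lemma poly_ring_a_inv:
  fixes p :: "('v, 'k::field) mpoly"
  assumes "p \<in> carrier (poly_ring V)"
  shows "a_inv (poly_ring V) p = - p"
proof -
  interpret cring "poly_ring V :: ('v, 'k) mpoly ring" by (rule cring_poly_ring)
  show ?thesis
    by (rule minus_equality) (use assms poly_ring_uminus_closed in auto)
qed

lemma sum_of_terms: "p = (\<Sum>m\<in>Poly_Mapping.keys p. Poly_Mapping.single m (Poly_Mapping.lookup p m))"
  by (rule poly_mapping_eqI)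
    (simp add: lookup_sum lookup_single when_def sum.delta in_keys_iff)

lemma const_mult_monomial: "const c * monomial m = Poly_Mapping.single m c"
  by (simp add: const_def mult_single)

lemma ideal_monom_ideal:
  assumes up: "\<And>m n. m \<in> B \<Longrightarrow> m + n \<in> B"
  shows "ideal (monom_ideal V B :: ('v, 'k::field) mpoly set) (poly_ring V)"
proof -
  interpret cring "poly_ring V :: ('v, 'k) mpoly ring" by (rule cring_poly_ring)
  have absorb: "r * p \<in> monom_ideal V B"
    if "p \<in> monom_ideal V B" "r \<in> carrier (poly_ring V)" for p r :: "('v, 'k) mpoly"
  proof -
    have "k \<in> B" if k: "k \<in> Poly_Mapping.keys (r * p)" for k
    proof -
      obtain a b where "k = a + b" "b \<in> Poly_Mapping.keys p"
        using subsetD[OF keys_mult k] by blast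
      then show ?thesis
        using \<open>p \<in> _\<close> up[of b a] by (auto simp: monom_ideal_def add.commute)
    qed
    then show ?thesis using that by (auto simp: monom_ideal_def poly_ring_closed)
  qed
  show ?thesis
  proof (rule idealI)
    show "ring (poly_ring V :: ('v, 'k) mpoly ring)" by (rule ring_axioms)
    show "subgroup (monom_ideal V B :: ('v, 'k) mpoly set) (add_monoid (poly_ring V))"
    proof (rule add.subgroupI)
      show "(monom_ideal V B :: ('v, 'k) mpoly set) \<subseteq> carrier (poly_ring V)" by (auto simp: monom_ideal_def)
      show "(monom_ideal V B :: ('v, 'k) mpoly set) \<noteq> {}"
        using zero_closed by (auto simp: monom_ideal_def intro!: exI[of _ 0])
      fix a b :: "('v, 'k) mpoly"
      assume a: "a \<in> monom_ideal V B" and b: "b \<in> monom_ideal V B"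
      show "\<ominus>\<^bsub>poly_ring V\<^esub> a \<in> monom_ideal V B"
        using a by (simp add: monom_ideal_def poly_ring_a_inv poly_ring_uminus_closed)
      show "a \<oplus>\<^bsub>poly_ring V\<^esub> b \<in> monom_ideal V B"
        using a b by (auto simp: monom_ideal_def poly_ring_closed dest!: subsetD[OF Poly_Mapping.keys_add])
    qed
  qed (use absorb in \<open>simp_all add: mult.commute\<close>)
qed

lemma monom_ideal_subset_ideal:
  fixes I :: "('v, 'k::field) mpoly set"
  assumes I: "ideal I (poly_ring V)"
    and gen: "\<And>m. m \<in> B \<Longrightarrow> Poly_Mapping.keys m \<subseteq> V \<Longrightarrow> monomial m \<in> I"
  shows "monom_ideal V B \<subseteq> I"
proof
  fix p :: "('v, 'k) mpoly" assume p: "p \<in> monom_ideal V B"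
  note I_closed = additive_subgroup.zero_closed[OF ideal.axioms(1)[OF I]]
    additive_subgroup.a_closed[OF ideal.axioms(1)[OF I]] ideal.I_l_closed[OF I]
  have "(\<Sum>m\<in>K. Poly_Mapping.single m (Poly_Mapping.lookup p m)) \<in> I"
    if "finite K" "K \<subseteq> Poly_Mapping.keys p" for K
    using that
  proof (induction K)
    case empty
    show ?case using I_closed(1) by simp
  next
    case (insert m K)
    have "m \<in> B" "Poly_Mapping.keys m \<subseteq> V"
      using p insert.prems by (auto simp: monom_ideal_def poly_ring_carrier_iff)
    then have "const (Poly_Mapping.lookup p m) * monomial m \<in> I"
      using I_closed(3)[OF gen, of m "const (Poly_Mapping.lookup p m)"] by simp
    then show ?case
      using insert I_closed(2) by (simp add: const_mult_monomial)
  qed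
  then show "p \<in> I" by (subst sum_of_terms) simp
qed

text \<open>The monomials outside the edge ideal. The two branches spell out that \<open>u v\<close> does not divide \<open>m\<close>; for a
loop, \<open>u v\<close> is the square \<open>u\<^sup>2\<close>.\<close>

definition standard :: "'v loop_graph \<Rightarrow> ('v \<Rightarrow>\<^sub>0 nat) \<Rightarrow> bool" where
  "standard H m \<longleftrightarrow> (\<forall>u v. {u, v} \<in> edges H \<longrightarrow>
     (if u = v then Poly_Mapping.lookup m u \<le> 1
      else Poly_Mapping.lookup m u = 0 \<or> Poly_Mapping.lookup m v = 0))"

lemma standardD:
  assumes "standard H m"
  shows "{u, v} \<in> edges H \<Longrightarrow> u \<noteq> v \<Longrightarrow> Poly_Mapping.lookup m u = 0 \<or> Poly_Mapping.lookup m v = 0"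
    and "{v} \<in> edges H \<Longrightarrow> Poly_Mapping.lookup m v \<le> 1"
proof -
  have *: "{u, v} \<in> edges H \<longrightarrow> (if u = v then Poly_Mapping.lookup m u \<le> 1
      else Poly_Mapping.lookup m u = 0 \<or> Poly_Mapping.lookup m v = 0)" for u v
    using assms unfolding standard_def by (elim allE)
  show "{u, v} \<in> edges H \<Longrightarrow> u \<noteq> v \<Longrightarrow> Poly_Mapping.lookup m u = 0 \<or> Poly_Mapping.lookup m v = 0"
    using *[of u v] by simp
  show "{v} \<in> edges H \<Longrightarrow> Poly_Mapping.lookup m v \<le> 1"
    using *[of v v] by simp
qed

lemma not_standard_iff:
  "\<not> standard H m \<longleftrightarrow>
     (\<exists>u v n. {u, v} \<in> edges H \<and> m = Poly_Mapping.single u 1 + Poly_Mapping.single v 1 + n)"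
proof
  assume "\<not> standard H m"
  then obtain u v where uv: "{u, v} \<in> edges H"
    and neg: "\<not> (if u = v then Poly_Mapping.lookup m u \<le> 1
      else Poly_Mapping.lookup m u = 0 \<or> Poly_Mapping.lookup m v = 0)"
    unfolding standard_def by blast
  then have *: "if u = v then Poly_Mapping.lookup m u \<ge> 2
      else Poly_Mapping.lookup m u \<noteq> 0 \<and> Poly_Mapping.lookup m v \<noteq> 0"
    by (simp split: if_splits)
  have "m = Poly_Mapping.single u 1 + Poly_Mapping.single v 1
      + (m - (Poly_Mapping.single u 1 + Poly_Mapping.single v 1))"
    by (rule poly_mapping_eqI)
      (use * in \<open>auto simp: lookup_add lookup_minus lookup_single when_def split: if_splits\<close>)
  with uv show "\<exists>u v n. {u, v} \<in> edges H \<and> m = Poly_Mapping.single u 1 + Poly_Mapping.single v 1 + n"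
    by blast
next
  assume "\<exists>u v n. {u, v} \<in> edges H \<and> m = Poly_Mapping.single u 1 + Poly_Mapping.single v 1 + n"
  then obtain u v n where "{u, v} \<in> edges H" "m = Poly_Mapping.single u 1 + Poly_Mapping.single v 1 + n"
    by blast
  then have "{u, v} \<in> edges H" "\<not> (if u = v then Poly_Mapping.lookup m u \<le> 1
      else Poly_Mapping.lookup m u = 0 \<or> Poly_Mapping.lookup m v = 0)"
    by (simp_all add: lookup_add lookup_single when_def)
  then show "\<not> standard H m"
    unfolding standard_def by blast
qed

lemma not_standard_multiple: "\<not> standard H m \<Longrightarrow> \<not> standard H (m + n)"
  unfolding not_standard_iff by (metis add.assoc)

lemma edge_ideal_eq:
  assumes fin: "finite_loop_graph H"
  shows "(edge_ideal H :: ('v, 'k::field) mpoly set) = monom_ideal (verts H) {m. \<not> standard H m}"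
    (is "?E = ?M")
proof -
  let ?gens = "{var u * var v | u v. {u, v} \<in> edges H} :: ('v, 'k) mpoly set"
  interpret cring "poly_ring (verts H) :: ('v, 'k) mpoly ring" by (rule cring_poly_ring)
  have gen: "var u * var v = (monomial (Poly_Mapping.single u 1 + Poly_Mapping.single v 1) :: ('v, 'k) mpoly)"
    for u v by (simp add: var_def mult_single)
  have vs: "u \<in> verts H \<and> v \<in> verts H" if "{u, v} \<in> edges H" for u v
    using fin that unfolding finite_loop_graph_def by (metis doubleton_eq_iff)
  have gens_sub: "?gens \<subseteq> ?M"
  proof
    fix p assume "p \<in> ?gens"
    then obtain u v where uv: "{u, v} \<in> edges H" and p: "p = var u * var v" by blast
    have "\<not> standard H (Poly_Mapping.single u 1 + Poly_Mapping.single v 1)"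
      unfolding not_standard_iff using uv by (metis add.right_neutral)
    then show "p \<in> ?M"
      using vs[OF uv] unfolding p gen monom_ideal_def
      by (auto simp: poly_ring_carrier_iff dest!: subsetD[OF Poly_Mapping.keys_add])
  qed
  have M: "ideal ?M (poly_ring (verts H))"
    by (rule ideal_monom_ideal) (use not_standard_multiple in auto)
  have gens_carrier: "?gens \<subseteq> carrier (poly_ring (verts H))"
    using gens_sub by (auto simp: monom_ideal_def)
  show ?thesis
  proof
    show "?E \<subseteq> ?M" unfolding edge_ideal_def by (rule genideal_minimal[OF M gens_sub])
    have E: "ideal ?E (poly_ring (verts H))"
      unfolding edge_ideal_def by (rule genideal_ideal[OF gens_carrier])
    show "?M \<subseteq> ?E"
    proof (rule monom_ideal_subset_ideal[OF E])
      fix m assume m: "m \<in> {m. \<not> standard H m}" and mV: "Poly_Mapping.keys m \<subseteq> verts H"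
      obtain u v n where uv: "{u, v} \<in> edges H"
        and m_eq: "m = Poly_Mapping.single u 1 + Poly_Mapping.single v 1 + n"
        using m unfolding mem_Collect_eq not_standard_iff by blast
      have "Poly_Mapping.keys n \<subseteq> Poly_Mapping.keys m"
        unfolding m_eq by (auto simp: in_keys_iff lookup_add)
      then have "monomial n \<in> carrier (poly_ring (verts H) :: ('v, 'k) mpoly ring)"
        using mV by (intro monom_in_carrier) auto
      moreover have "var u * var v \<in> ?E"
        unfolding edge_ideal_def using genideal_self[OF gens_carrier] uv by blast
      ultimately have "monomial n * (var u * var v) \<in> ?E"
        using ideal.I_l_closed[OF E] by fastforce
      then show "monomial m \<in> ?E"
        by (simp add: gen mult_single m_eq add.commute)
    qed
  qed
qed

lemma ideal_edge_ideal:
  assumes "finite_loop_graph H"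
  shows "ideal (edge_ideal H :: ('v, 'k::field) mpoly set) (poly_ring (verts H))"
  unfolding edge_ideal_eq[OF assms] by (rule ideal_monom_ideal) (use not_standard_multiple in auto)

section \<open>Primes generated by variables\<close>

lemma keys_add_nat: "Poly_Mapping.keys (m + n) = Poly_Mapping.keys m \<union> Poly_Mapping.keys n"
  for m n :: "'v \<Rightarrow>\<^sub>0 nat"
  unfolding set_eq_iff Un_iff in_keys_iff lookup_add by simp

text \<open>Lexicographic leading terms, without an order on the variables: keep only the monomials of highest
degree in one variable, on both sides, and recurse on the remaining variables. A sum that equals the
sum of two top elements must itself be made of top elements.\<close>

lemma unique_sum_of_monomials:
  fixes K L :: "('v \<Rightarrow>\<^sub>0 nat) set"
  assumes "finite U" "finite K" "finite L" "K \<noteq> {}" "L \<noteq> {}"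
    and "\<And>m m' v. m \<in> K \<Longrightarrow> m' \<in> K \<Longrightarrow> v \<notin> U \<Longrightarrow> Poly_Mapping.lookup m v = Poly_Mapping.lookup m' v"
    and "\<And>n n' v. n \<in> L \<Longrightarrow> n' \<in> L \<Longrightarrow> v \<notin> U \<Longrightarrow> Poly_Mapping.lookup n v = Poly_Mapping.lookup n' v"
  shows "\<exists>m0\<in>K. \<exists>n0\<in>L. \<forall>m\<in>K. \<forall>n\<in>L. m + n = m0 + n0 \<longrightarrow> m = m0 \<and> n = n0"
  using assms
proof (induction U arbitrary: K L rule: finite_induct)
  case empty
  have "m = m'" if "m \<in> K" "m' \<in> K" for m m'
    by (rule poly_mapping_eqI) (rule empty.prems(5)[OF that], simp)
  moreover have "n = n'" if "n \<in> L" "n' \<in> L" for n n'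
    by (rule poly_mapping_eqI) (rule empty.prems(6)[OF that], simp)
  ultimately show ?case using empty.prems(3,4) by blast
next
  case (insert v U)
  let ?top = "\<lambda>M. {m \<in> M. Poly_Mapping.lookup m v = Max ((\<lambda>m. Poly_Mapping.lookup m v) ` M)}"
  have top_ne: "?top M \<noteq> {}" if "finite M" "M \<noteq> {}" for M :: "('v \<Rightarrow>\<^sub>0 nat) set"
  proof -
    have "Max ((\<lambda>m. Poly_Mapping.lookup m v) ` M) \<in> (\<lambda>m. Poly_Mapping.lookup m v) ` M"
      using that by (intro Max_in) auto
    then obtain m where "Max ((\<lambda>m. Poly_Mapping.lookup m v) ` M) = Poly_Mapping.lookup m v" "m \<in> M"
      by (rule imageE)
    then have "m \<in> ?top M" by simp
    then show ?thesis by blast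
  qed
  have le_top: "Poly_Mapping.lookup m v \<le> Max ((\<lambda>m. Poly_Mapping.lookup m v) ` M)"
    if "finite M" "m \<in> M" for m and M :: "('v \<Rightarrow>\<^sub>0 nat) set"
    using that by simp
  have "\<exists>m0\<in>?top K. \<exists>n0\<in>?top L. \<forall>m\<in>?top K. \<forall>n\<in>?top L. m + n = m0 + n0 \<longrightarrow> m = m0 \<and> n = n0"
  proof (rule insert.IH)
    show "?top K \<noteq> {}" "?top L \<noteq> {}" by (intro top_ne insert.prems)+
    show "finite (?top K)" "finite (?top L)" using insert.prems(1,2) by simp_all
    fix m m' w assume "m \<in> ?top K" "m' \<in> ?top K" "w \<notin> U"
    then show "Poly_Mapping.lookup m w = Poly_Mapping.lookup m' w"
      using insert.prems(5)[of m m' w] by (cases "w = v") simp_all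
  next
    fix m m' w assume "m \<in> ?top L" "m' \<in> ?top L" "w \<notin> U"
    then show "Poly_Mapping.lookup m w = Poly_Mapping.lookup m' w"
      using insert.prems(6)[of m m' w] by (cases "w = v") simp_all
  qed
  then obtain m0 where m0: "m0 \<in> ?top K"
    and "\<exists>n0\<in>?top L. \<forall>m\<in>?top K. \<forall>n\<in>?top L. m + n = m0 + n0 \<longrightarrow> m = m0 \<and> n = n0"
    by (rule bexE)
  then obtain n0 where n0: "n0 \<in> ?top L"
    and unique: "\<forall>m\<in>?top K. \<forall>n\<in>?top L. m + n = m0 + n0 \<longrightarrow> m = m0 \<and> n = n0"
    by (elim bexE)
  have "m = m0 \<and> n = n0" if "m \<in> K" "n \<in> L" "m + n = m0 + n0" for m n
  proof -
    have "Poly_Mapping.lookup m v + Poly_Mapping.lookup n v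
        = Poly_Mapping.lookup m0 v + Poly_Mapping.lookup n0 v"
      using that(3) by (metis lookup_add)
    moreover have "Poly_Mapping.lookup m v \<le> Poly_Mapping.lookup m0 v"
      "Poly_Mapping.lookup n v \<le> Poly_Mapping.lookup n0 v"
      using le_top[OF insert.prems(1) that(1)] le_top[OF insert.prems(2) that(2)] m0 n0 by simp_all
    ultimately have "Poly_Mapping.lookup m v = Poly_Mapping.lookup m0 v"
      "Poly_Mapping.lookup n v = Poly_Mapping.lookup n0 v" by linarith+
    then have "m \<in> ?top K" "n \<in> ?top L"
      using that(1,2) m0 n0 by simp_all
    then show ?thesis using unique that(3) by blast
  qed
  then show ?case using m0 n0 by blast
qed

text \<open>If only one pair of monomials multiplies to \<open>m0 + n0\<close>, no cancellation can occur there.\<close>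

lemma lookup_mult_unique:
  fixes p q :: "('v, 'k::field) mpoly"
  assumes "\<And>m n. m \<in> Poly_Mapping.keys p \<Longrightarrow> n \<in> Poly_Mapping.keys q \<Longrightarrow> m + n = m0 + n0 \<Longrightarrow> m = m0 \<and> n = n0"
  shows "Poly_Mapping.lookup (p * q) (m0 + n0) = Poly_Mapping.lookup p m0 * Poly_Mapping.lookup q n0"
proof -
  define a where "a = Poly_Mapping.single m0 (Poly_Mapping.lookup p m0)"
  define b where "b = Poly_Mapping.single n0 (Poly_Mapping.lookup q n0)"
  have p': "m \<in> Poly_Mapping.keys (p - a) \<longleftrightarrow> m \<in> Poly_Mapping.keys p \<and> m \<noteq> m0" for m
    by (auto simp: a_def in_keys_iff lookup_minus lookup_single when_def)
  have q': "n \<in> Poly_Mapping.keys (q - b) \<longleftrightarrow> n \<in> Poly_Mapping.keys q \<and> n \<noteq> n0" for n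
    by (auto simp: b_def in_keys_iff lookup_minus lookup_single when_def)
  have "m0 + n0 \<notin> Poly_Mapping.keys ((p - a) * q)"
    using keys_mult[of "p - a" q] assms p' by fastforce
  moreover have "m0 + n0 \<notin> Poly_Mapping.keys (a * (q - b))"
    using keys_mult[of a "q - b"] q' by (auto simp: a_def split: if_splits)
  moreover have "p * q = (p - a) * q + a * (q - b) + a * b"
    by (simp add: algebra_simps)
  ultimately show ?thesis
    by (simp add: lookup_add in_keys_iff a_def b_def mult_single)
qed

lemma keys_mult_monomial:
  fixes p :: "('v, 'k::field) mpoly"
  shows "Poly_Mapping.keys (p * monomial m) = (\<lambda>k. k + m) ` Poly_Mapping.keys p"
proof
  show "Poly_Mapping.keys (p * monomial m) \<subseteq> (\<lambda>k. k + m) ` Poly_Mapping.keys p"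
    using keys_mult[of p "monomial m :: ('v, 'k) mpoly"] by auto
  have "Poly_Mapping.lookup (p * monomial m) (k + m) = Poly_Mapping.lookup p k" for k
    by (subst lookup_mult_unique) auto
  then show "(\<lambda>k. k + m) ` Poly_Mapping.keys p \<subseteq> Poly_Mapping.keys (p * monomial m)"
    by (auto simp: in_keys_iff)
qed

definition var_prime :: "'v set \<Rightarrow> 'v set \<Rightarrow> ('v, 'k::field) mpoly set" where
  "var_prime V S = monom_ideal V {m. Poly_Mapping.keys m \<inter> S \<noteq> {}}"

text \<open>Outside the ideal, a polynomial has a term free of the variables in \<open>S\<close>. Among these terms of two
such polynomials a pair with unique sum produces a term of the product free of \<open>S\<close>.\<close>

lemma primeideal_var_prime:
  "primeideal (var_prime V S :: ('v, 'k::field) mpoly set) (poly_ring V)"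
proof (rule primeidealI)
  show "ideal (var_prime V S :: ('v, 'k) mpoly set) (poly_ring V)"
    unfolding var_prime_def by (rule ideal_monom_ideal) (auto simp: in_keys_iff lookup_add)
  show "cring (poly_ring V :: ('v, 'k) mpoly ring)" by (rule cring_poly_ring)
  have "(1 :: ('v, 'k) mpoly) \<notin> var_prime V S"
    by (simp add: var_prime_def monom_ideal_def)
  moreover have "(1 :: ('v, 'k) mpoly) \<in> carrier (poly_ring V)"
    by (simp add: poly_ring_carrier_iff)
  ultimately show "carrier (poly_ring V) \<noteq> (var_prime V S :: ('v, 'k) mpoly set)" by metis
  fix p q :: "('v, 'k) mpoly"
  assume p: "p \<in> carrier (poly_ring V)" and q: "q \<in> carrier (poly_ring V)"
    and pq: "p \<otimes>\<^bsub>poly_ring V\<^esub> q \<in> var_prime V S"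
  show "p \<in> var_prime V S \<or> q \<in> var_prime V S"
  proof (rule ccontr)
    assume neg: "\<not> ?thesis"
    let ?free = "\<lambda>p :: ('v, 'k) mpoly. {m \<in> Poly_Mapping.keys p. Poly_Mapping.keys m \<inter> S = {}}"
    \<comment> \<open>outside \<open>U\<close> all exponents are zero, so all monomials involved agree there\<close>
    define U where "U = \<Union>(Poly_Mapping.keys ` (Poly_Mapping.keys p \<union> Poly_Mapping.keys q))"
    have "\<exists>m0\<in>?free p. \<exists>n0\<in>?free q. \<forall>m\<in>?free p. \<forall>n\<in>?free q. m + n = m0 + n0 \<longrightarrow> m = m0 \<and> n = n0"
    proof (rule unique_sum_of_monomials[of U])
      show "finite U" by (simp add: U_def)
      show "?free p \<noteq> {}" "?free q \<noteq> {}"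
        using neg p q by (auto simp: var_prime_def monom_ideal_def)
    qed (auto simp: U_def in_keys_iff)
    then obtain m0 n0 where m0: "m0 \<in> ?free p" and n0: "n0 \<in> ?free q"
      and unique: "\<And>m n. m \<in> ?free p \<Longrightarrow> n \<in> ?free q \<Longrightarrow> m + n = m0 + n0 \<Longrightarrow> m = m0 \<and> n = n0"
      by blast
    have "Poly_Mapping.lookup (p * q) (m0 + n0) = Poly_Mapping.lookup p m0 * Poly_Mapping.lookup q n0"
    proof (rule lookup_mult_unique)
      fix m n assume mn: "m \<in> Poly_Mapping.keys p" "n \<in> Poly_Mapping.keys q" "m + n = m0 + n0"
      then have "Poly_Mapping.keys m \<union> Poly_Mapping.keys n = Poly_Mapping.keys m0 \<union> Poly_Mapping.keys n0"
        by (metis keys_add_nat)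
      then show "m = m0 \<and> n = n0" using mn m0 n0 by (intro unique) auto
    qed
    then have "m0 + n0 \<in> Poly_Mapping.keys (p * q)"
      using m0 n0 by (auto simp: in_keys_iff)
    moreover have "Poly_Mapping.keys (m0 + n0) \<inter> S = {}"
      using m0 n0 by (auto simp: keys_add_nat)
    ultimately show False using pq by (auto simp: var_prime_def monom_ideal_def)
  qed
qed

section \<open>Hilbert series of monomial ideals\<close>

lemma quot_monom_ideal_hom:
  assumes "\<And>m n. m \<in> B \<Longrightarrow> m + n \<in> B"
  shows "ring_hom_ring (poly_ring V) (poly_ring V Quot monom_ideal V B)
    ((+>\<^bsub>poly_ring V :: ('v, 'k::field) mpoly ring\<^esub>) (monom_ideal V B))"
  by (rule ideal.rcos_ring_hom_ring[OF ideal_monom_ideal]) (rule assms)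

lemma coset_eq_iff:
  fixes J :: "('v, 'k::field) mpoly set"
  assumes J: "ideal J (poly_ring V)" and "p \<in> carrier (poly_ring V)" "q \<in> carrier (poly_ring V)"
  shows "J +>\<^bsub>poly_ring V\<^esub> p = J +>\<^bsub>poly_ring V\<^esub> q \<longleftrightarrow> p - q \<in> J"
proof -
  interpret cring "poly_ring V :: ('v, 'k) mpoly ring" by (rule cring_poly_ring)
  show ?thesis
    using quotient_eq_iff_same_a_r_cos[OF assms] assms
    by (simp add: a_minus_def poly_ring_a_inv)
qed

text \<open>Together with the next lemma this identifies a basis of each graded component of \<open>k[V]/J\<close>.\<close>

lemma Span_monoms:
  fixes V :: "'v set" and B :: "('v \<Rightarrow>\<^sub>0 nat) set"
  defines "J \<equiv> (monom_ideal V B :: ('v, 'k::field) mpoly set)"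
  assumes up: "\<And>m n. m \<in> B \<Longrightarrow> m + n \<in> B"
    and ms: "\<And>m. m \<in> set ms \<Longrightarrow> Poly_Mapping.keys m \<subseteq> V"
  shows "ring.Span (poly_ring V Quot J) (quot_scalars V J) (map (\<lambda>m. J +>\<^bsub>poly_ring V\<^esub> monomial m) ms)
    = {J +>\<^bsub>poly_ring V\<^esub> p | p. Poly_Mapping.keys p \<subseteq> set ms}"
proof -
  interpret h: ring_hom_ring "poly_ring V" "poly_ring V Quot J" "(+>\<^bsub>poly_ring V\<^esub>) J"
    unfolding J_def by (rule quot_monom_ideal_hom) (rule up)
  show ?thesis using ms
  proof (induction ms)
    case Nil
    then show ?case using h.hom_zero by (simp add: h.S.Span.simps)
  next
    case (Cons m ms)
    have carrier: "p \<in> carrier (poly_ring V)" if "Poly_Mapping.keys p \<subseteq> set (m # ms)"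
      for p :: "('v, 'k) mpoly"
      using that Cons.prems by (fastforce simp: poly_ring_carrier_iff)
    have m: "monomial m \<in> carrier (poly_ring V :: ('v, 'k) mpoly ring)"
      by (rule carrier) simp
    have comb: "(J +>\<^bsub>poly_ring V\<^esub> const c) \<otimes>\<^bsub>poly_ring V Quot J\<^esub> (J +>\<^bsub>poly_ring V\<^esub> monomial m)
        \<oplus>\<^bsub>poly_ring V Quot J\<^esub> (J +>\<^bsub>poly_ring V\<^esub> p) = J +>\<^bsub>poly_ring V\<^esub> (Poly_Mapping.single m c + p)"
      if "Poly_Mapping.keys p \<subseteq> set ms" for c and p :: "('v, 'k) mpoly"
    proof -
      have p: "p \<in> carrier (poly_ring V)" using that by (intro carrier) auto
      have "J +>\<^bsub>poly_ring V\<^esub> (const c \<otimes>\<^bsub>poly_ring V\<^esub> monomial m \<oplus>\<^bsub>poly_ring V\<^esub> p)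
        = (J +>\<^bsub>poly_ring V\<^esub> const c) \<otimes>\<^bsub>poly_ring V Quot J\<^esub> (J +>\<^bsub>poly_ring V\<^esub> monomial m)
        \<oplus>\<^bsub>poly_ring V Quot J\<^esub> (J +>\<^bsub>poly_ring V\<^esub> p)"
        using m p h.R.m_closed[of "const c" "monomial m"] by (simp only: h.hom_add h.hom_mult const_in_carrier)
      then show ?thesis by (simp add: const_mult_monomial)
    qed
    have IH: "h.S.Span (quot_scalars V J) (map (\<lambda>m. J +>\<^bsub>poly_ring V\<^esub> monomial m) ms)
      = {J +>\<^bsub>poly_ring V\<^esub> p | p. Poly_Mapping.keys p \<subseteq> set ms}"
      using Cons.IH Cons.prems by simp
    have Span_iff: "u \<in> h.S.Span (quot_scalars V J) (map (\<lambda>m. J +>\<^bsub>poly_ring V\<^esub> monomial m) (m # ms))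
      \<longleftrightarrow> (\<exists>c p. Poly_Mapping.keys p \<subseteq> set ms \<and> u = J +>\<^bsub>poly_ring V\<^esub> (Poly_Mapping.single m c + p))"
      for u
    proof -
      have "u \<in> h.S.Span (quot_scalars V J) (map (\<lambda>m. J +>\<^bsub>poly_ring V\<^esub> monomial m) (m # ms))
        \<longleftrightarrow> u \<in> h.S.line_extension (quot_scalars V J) (J +>\<^bsub>poly_ring V\<^esub> monomial m)
           {J +>\<^bsub>poly_ring V\<^esub> p | p. Poly_Mapping.keys p \<subseteq> set ms}"
        using IH by simp
      also have "\<dots> \<longleftrightarrow> (\<exists>c p. Poly_Mapping.keys p \<subseteq> set ms \<and>
        u = (J +>\<^bsub>poly_ring V\<^esub> const c) \<otimes>\<^bsub>poly_ring V Quot J\<^esub> (J +>\<^bsub>poly_ring V\<^esub> monomial m)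
        \<oplus>\<^bsub>poly_ring V Quot J\<^esub> (J +>\<^bsub>poly_ring V\<^esub> p))"
        unfolding h.S.line_extension_mem_iff quot_scalars_def by blast
      also have "\<dots> \<longleftrightarrow> (\<exists>c p. Poly_Mapping.keys p \<subseteq> set ms \<and>
          u = J +>\<^bsub>poly_ring V\<^esub> (Poly_Mapping.single m c + p))"
        by (intro ex_cong1 conj_cong refl) (simp only: comb)
      finally show ?thesis .
    qed
    have keys_iff: "(\<exists>c p. Poly_Mapping.keys p \<subseteq> set ms \<and> q = Poly_Mapping.single m c + p)
      \<longleftrightarrow> Poly_Mapping.keys q \<subseteq> set (m # ms)" for q :: "('v, 'k) mpoly"
    proof
      assume "\<exists>c p. Poly_Mapping.keys p \<subseteq> set ms \<and> q = Poly_Mapping.single m c + p"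
      then obtain c p where "Poly_Mapping.keys p \<subseteq> set ms" "q = Poly_Mapping.single m c + p" by blast
      then show "Poly_Mapping.keys q \<subseteq> set (m # ms)"
        using Poly_Mapping.keys_add[of "Poly_Mapping.single m c" p] by (auto split: if_splits)
    next
      assume q: "Poly_Mapping.keys q \<subseteq> set (m # ms)"
      let ?c = "Poly_Mapping.lookup q m"
      have "Poly_Mapping.keys (q - Poly_Mapping.single m ?c) \<subseteq> set ms"
      proof
        fix x assume "x \<in> Poly_Mapping.keys (q - Poly_Mapping.single m ?c)"
        then have "x \<noteq> m" "x \<in> Poly_Mapping.keys q"
          by (auto simp: in_keys_iff lookup_minus lookup_single when_def split: if_splits)
        then show "x \<in> set ms" using q by auto
      qed
      moreover have "q = Poly_Mapping.single m ?c + (q - Poly_Mapping.single m ?c)" by simp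
      ultimately show "\<exists>c p. Poly_Mapping.keys p \<subseteq> set ms \<and> q = Poly_Mapping.single m c + p" by blast
    qed
    show ?case
    proof (rule Set.set_eqI)
      fix u
      have "u \<in> h.S.Span (quot_scalars V J) (map (\<lambda>m. J +>\<^bsub>poly_ring V\<^esub> monomial m) (m # ms))
        \<longleftrightarrow> (\<exists>q. (\<exists>c p. Poly_Mapping.keys p \<subseteq> set ms \<and> q = Poly_Mapping.single m c + p)
          \<and> u = J +>\<^bsub>poly_ring V\<^esub> q)"
        unfolding Span_iff by blast
      then show "u \<in> h.S.Span (quot_scalars V J) (map (\<lambda>m. J +>\<^bsub>poly_ring V\<^esub> monomial m) (m # ms))
        \<longleftrightarrow> u \<in> {J +>\<^bsub>poly_ring V\<^esub> q | q. Poly_Mapping.keys q \<subseteq> set (m # ms)}"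
        unfolding keys_iff by blast
    qed
  qed
qed

lemma independent_standard_monoms:
  fixes V :: "'v set" and B :: "('v \<Rightarrow>\<^sub>0 nat) set"
  defines "J \<equiv> (monom_ideal V B :: ('v, 'k::field) mpoly set)"
  assumes up: "\<And>m n. m \<in> B \<Longrightarrow> m + n \<in> B"
    and ms: "\<And>m. m \<in> set ms \<Longrightarrow> Poly_Mapping.keys m \<subseteq> V \<and> m \<notin> B" and "distinct ms"
  shows "ring.independent (poly_ring V Quot J) (quot_scalars V J)
    (map (\<lambda>m. J +>\<^bsub>poly_ring V\<^esub> monomial m) ms)"
proof -
  interpret h: ring_hom_ring "poly_ring V" "poly_ring V Quot J" "(+>\<^bsub>poly_ring V\<^esub>) J"
    unfolding J_def by (rule quot_monom_ideal_hom) (rule up)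
  have J: "ideal J (poly_ring V)" unfolding J_def by (rule ideal_monom_ideal) (rule up)
  show ?thesis using ms \<open>distinct ms\<close>
  proof (induction ms)
    case Nil
    show ?case by simp
  next
    case (Cons m ms)
    have m: "monomial m \<in> carrier (poly_ring V :: ('v, 'k) mpoly ring)"
      using Cons.prems(1) by (simp add: monom_in_carrier)
    have "J +>\<^bsub>poly_ring V\<^esub> monomial m \<notin> h.S.Span (quot_scalars V J) (map (\<lambda>m. J +>\<^bsub>poly_ring V\<^esub> monomial m) ms)"
    proof
      assume "J +>\<^bsub>poly_ring V\<^esub> monomial m \<in> h.S.Span (quot_scalars V J) (map (\<lambda>m. J +>\<^bsub>poly_ring V\<^esub> monomial m) ms)"
      moreover have "h.S.Span (quot_scalars V J) (map (\<lambda>m. J +>\<^bsub>poly_ring V\<^esub> monomial m) ms)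
        = {J +>\<^bsub>poly_ring V\<^esub> p | p. Poly_Mapping.keys p \<subseteq> set ms}"
        unfolding J_def by (rule Span_monoms) (use up Cons.prems(1) in auto)
      ultimately obtain p where p: "Poly_Mapping.keys p \<subseteq> set ms"
        and eq: "J +>\<^bsub>poly_ring V\<^esub> monomial m = J +>\<^bsub>poly_ring V\<^esub> p" by auto
      have "p \<in> carrier (poly_ring V)"
        using p Cons.prems(1) by (fastforce simp: poly_ring_carrier_iff)
      then have "monomial m - p \<in> J" using eq coset_eq_iff[OF J m] by blast
      moreover have "Poly_Mapping.lookup p m = 0"
        using p Cons.prems(2) by (auto simp: in_keys_iff)
      then have "m \<in> Poly_Mapping.keys (monomial m - p)"
        by (simp add: in_keys_iff lookup_minus)
      ultimately show False using Cons.prems(1) by (auto simp: J_def monom_ideal_def)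
    qed
    then show ?case
      using Cons h.hom_closed[OF m] by (auto intro: h.S.independent.li_Cons)
  qed
qed

text \<open>Dimensions are unique only over a subfield, and the scalars form one because \<open>1\<close> is not in the ideal.\<close>

lemma subfield_quot_scalars:
  assumes up: "\<And>m n. m \<in> B \<Longrightarrow> m + n \<in> B" and proper: "0 \<notin> B"
  shows "subfield (quot_scalars V (monom_ideal V B :: ('v, 'k::field) mpoly set))
    (poly_ring V Quot monom_ideal V B)"
proof -
  let ?J = "monom_ideal V B :: ('v, 'k) mpoly set"
  let ?R = "poly_ring V :: ('v, 'k) mpoly ring"
  interpret h: ring_hom_ring ?R "?R Quot ?J" "(+>\<^bsub>?R\<^esub>) ?J"
    by (rule quot_monom_ideal_hom) (rule up)
  have J: "ideal ?J ?R" by (rule ideal_monom_ideal) (rule up)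
  have c: "const 0 = (0 :: ('v, 'k) mpoly)" "const 1 = (1 :: ('v, 'k) mpoly)"
    "const (a + b) = (const a + const b :: ('v, 'k) mpoly)"
    "const (a * b) = (const a * const b :: ('v, 'k) mpoly)"
    "const (- a) = (- const a :: ('v, 'k) mpoly)" for a b
    by (simp_all add: const_def single_add mult_single single_uminus)
  let ?K = "range const :: ('v, 'k) mpoly set"
  have "field (?R\<lparr>carrier := ?K\<rparr>)"
  proof (rule cring.cring_fieldI2)
    have "subring ?K ?R"
    proof (rule h.R.subringI)
      show "?K \<subseteq> carrier ?R" by auto
      show "\<one>\<^bsub>?R\<^esub> \<in> ?K" by (metis c(2) poly_ring_simps(2) rangeI)
      show "\<ominus>\<^bsub>?R\<^esub> p \<in> ?K" if pK: "p \<in> ?K" for p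
      proof -
        obtain a where "p = const a" using pK by auto
        then have "\<ominus>\<^bsub>?R\<^esub> p = const (- a)" by (simp add: c(5) poly_ring_a_inv)
        then show ?thesis by simp
      qed
      show "p \<otimes>\<^bsub>?R\<^esub> q \<in> ?K" "p \<oplus>\<^bsub>?R\<^esub> q \<in> ?K" if "p \<in> ?K" "q \<in> ?K" for p q
        using that by (auto simp flip: c(3,4))
    qed
    then have "subcring ?K ?R" by (rule h.R.subcringI) (auto simp: mult.commute)
    then show "cring (?R\<lparr>carrier := ?K\<rparr>)" by (subst (asm) h.R.subcring_iff) auto
    show "\<zero>\<^bsub>?R\<lparr>carrier := ?K\<rparr>\<^esub> \<noteq> \<one>\<^bsub>?R\<lparr>carrier := ?K\<rparr>\<^esub>" by simp
    fix p assume p: "p \<in> carrier (?R\<lparr>carrier := ?K\<rparr>)" "p \<noteq> \<zero>\<^bsub>?R\<lparr>carrier := ?K\<rparr>\<^esub>"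
    then obtain a where a: "p = const a" "a \<noteq> 0" using c(1) by auto
    then have "const a * const (inverse a) = (1 :: ('v, 'k) mpoly)"
      by (simp flip: c(4) add: c(2))
    then show "\<exists>b\<in>carrier (?R\<lparr>carrier := ?K\<rparr>). p \<otimes>\<^bsub>?R\<lparr>carrier := ?K\<rparr>\<^esub> b = \<one>\<^bsub>?R\<lparr>carrier := ?K\<rparr>\<^esub>"
      using a by auto
  qed
  then have K: "subfield ?K ?R" by (rule h.R.subfield_iff(1)) auto
  have "(1 :: ('v, 'k) mpoly) \<notin> ?J" using proper by (simp add: monom_ideal_def)
  then have "\<one>\<^bsub>?R Quot ?J\<^esub> \<noteq> \<zero>\<^bsub>?R Quot ?J\<^esub>"
    using coset_eq_iff[OF J, of 1 0] h.R.one_closed h.R.zero_closed h.hom_one h.hom_zero by simp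
  then have "subfield ((+>\<^bsub>?R\<^esub>) ?J ` ?K) (?R Quot ?J)"
    by (rule h.img_is_subfield(2)[OF K])
  moreover have "(+>\<^bsub>?R\<^esub>) ?J ` ?K = quot_scalars V ?J"
    by (auto simp: quot_scalars_def)
  ultimately show ?thesis by simp
qed

lemma lookup_le_monom_deg: "Poly_Mapping.lookup m v \<le> monom_deg m"
proof (cases "v \<in> Poly_Mapping.keys m")
  case True
  then show ?thesis unfolding monom_deg_def by (intro member_le_sum) auto
qed (simp add: in_keys_iff)

lemma finite_bounded_monoms:
  assumes "finite V"
  shows "finite {m :: 'v \<Rightarrow>\<^sub>0 nat. Poly_Mapping.keys m \<subseteq> V \<and> monom_deg m \<le> s}" (is "finite ?M")
proof (rule finite_imageD)
  have "Poly_Mapping.lookup ` ?M \<subseteq> {f. \<forall>v. (v \<in> V \<longrightarrow> f v \<in> {..s}) \<and> (v \<notin> V \<longrightarrow> f v = 0)}"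
  proof (intro image_subsetI CollectI allI conjI impI)
    fix m :: "'v \<Rightarrow>\<^sub>0 nat" and v assume m: "m \<in> ?M"
    then show "Poly_Mapping.lookup m v \<in> {..s}"
      using order_trans[OF lookup_le_monom_deg[of m v], of s] by simp
    assume "v \<notin> V"
    with m have "v \<notin> Poly_Mapping.keys m" by blast
    then show "Poly_Mapping.lookup m v = 0" by (simp add: in_keys_iff)
  qed
  then show "finite (Poly_Mapping.lookup ` ?M)"
    by (rule finite_subset) (rule finite_set_of_finite_funs[OF assms finite_atMost])
  show "inj_on Poly_Mapping.lookup ?M" by (rule inj_onI) (simp only: poly_mapping_eq_iff)
qed

text \<open>Dropping the terms in \<open>B\<close> does not change the class of a polynomial, so the classes of the remaining
monomials span, and they are independent because the ideal is spanned by its own monomials.\<close>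

lemma hilbert_series_monom_ideal:
  fixes V :: "'v set"
  assumes V: "finite V" and up: "\<And>m n. m \<in> B \<Longrightarrow> m + n \<in> B" and proper: "0 \<notin> B"
  shows "hilbert_series V (monom_ideal V B :: ('v, 'k::field) mpoly set)
    = Abs_fps (\<lambda>s. int (card {m. Poly_Mapping.keys m \<subseteq> V \<and> monom_deg m = s \<and> m \<notin> B}))"
proof -
  let ?J = "monom_ideal V B :: ('v, 'k) mpoly set"
  let ?R = "poly_ring V :: ('v, 'k) mpoly ring"
  interpret h: ring_hom_ring ?R "?R Quot ?J" "(+>\<^bsub>?R\<^esub>) ?J"
    by (rule quot_monom_ideal_hom) (rule up)
  have J: "ideal ?J ?R" by (rule ideal_monom_ideal) (rule up)
  have "h.S.dim (quot_scalars V ?J) (quot_comp V ?J s)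
    = card {m. Poly_Mapping.keys m \<subseteq> V \<and> monom_deg m = s \<and> m \<notin> B}" for s
  proof -
    let ?M = "{m. Poly_Mapping.keys m \<subseteq> V \<and> monom_deg m = s \<and> m \<notin> B}"
    have "finite ?M" by (rule finite_subset[OF _ finite_bounded_monoms[OF V, of s]]) auto
    from finite_distinct_list[OF this] obtain ms where ms: "set ms = ?M" "distinct ms" by (elim exE conjE)
    let ?Us = "map (\<lambda>m. ?J +>\<^bsub>?R\<^esub> monomial m) ms"
    have Span: "h.S.Span (quot_scalars V ?J) ?Us = {?J +>\<^bsub>?R\<^esub> p | p. Poly_Mapping.keys p \<subseteq> ?M}"
      unfolding ms(1)[symmetric] by (rule Span_monoms; (rule up)?; simp add: ms(1))
    have "quot_comp V ?J s = {?J +>\<^bsub>?R\<^esub> p | p. Poly_Mapping.keys p \<subseteq> ?M}"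
    proof
      show "{?J +>\<^bsub>?R\<^esub> p | p. Poly_Mapping.keys p \<subseteq> ?M} \<subseteq> quot_comp V ?J s"
      proof clarify
        fix p :: "('v, 'k) mpoly" assume p: "Poly_Mapping.keys p \<subseteq> ?M"
        then have "p \<in> carrier ?R" "\<forall>m\<in>Poly_Mapping.keys p. monom_deg m = s"
          unfolding poly_ring_carrier_iff by blast+
        then show "?J +>\<^bsub>?R\<^esub> p \<in> quot_comp V ?J s" unfolding quot_comp_def by blast
      qed
      show "quot_comp V ?J s \<subseteq> {?J +>\<^bsub>?R\<^esub> p | p. Poly_Mapping.keys p \<subseteq> ?M}"
      proof
        fix u assume "u \<in> quot_comp V ?J s"
        then obtain p where p: "p \<in> carrier ?R" "\<forall>m\<in>Poly_Mapping.keys p. monom_deg m = s"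
          and u: "u = ?J +>\<^bsub>?R\<^esub> p" unfolding quot_comp_def by blast
        define q where "q = (\<Sum>m\<in>Poly_Mapping.keys p - B. Poly_Mapping.single m (Poly_Mapping.lookup p m))"
        have lookup_q: "Poly_Mapping.lookup q m = (if m \<in> B then 0 else Poly_Mapping.lookup p m)" for m
          by (auto simp: q_def lookup_sum lookup_single when_def sum.delta in_keys_iff)
        have "m \<in> Poly_Mapping.keys p \<and> m \<notin> B" if "m \<in> Poly_Mapping.keys q" for m
          using that by (simp add: in_keys_iff lookup_q split: if_splits)
        then have q: "Poly_Mapping.keys q \<subseteq> ?M"
          using p unfolding poly_ring_carrier_iff by blast
        then have qc: "q \<in> carrier ?R" unfolding poly_ring_carrier_iff by blast
        have "Poly_Mapping.keys (p - q) \<subseteq> B"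
          by (auto simp: in_keys_iff lookup_minus lookup_q split: if_splits)
        then have "p - q \<in> ?J" using p(1) qc by (simp add: monom_ideal_def poly_ring_closed)
        then have "u = ?J +>\<^bsub>?R\<^esub> q" using u coset_eq_iff[OF J p(1) qc] by simp
        then show "u \<in> {?J +>\<^bsub>?R\<^esub> p | p. Poly_Mapping.keys p \<subseteq> ?M}" using q by blast
      qed
    qed
    moreover have "h.S.independent (quot_scalars V ?J) ?Us"
      by (rule independent_standard_monoms; (rule up)?; simp add: ms)
    then have "h.S.dimension (length ?Us) (quot_scalars V ?J) (h.S.Span (quot_scalars V ?J) ?Us)"
      by (rule h.S.dimension_independent)
    ultimately have "h.S.dimension (length ?Us) (quot_scalars V ?J) (quot_comp V ?J s)"
      unfolding Span by simp
    moreover have "subfield (quot_scalars V ?J) (?R Quot ?J)"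
      by (rule subfield_quot_scalars) (use up proper in auto)
    ultimately have "h.S.dim (quot_scalars V ?J) (quot_comp V ?J s) = length ?Us"
      using h.S.dimI unfolding over_def by blast
    also have "\<dots> = card ?M" using distinct_card[OF ms(2)] ms(1) by simp
    finally show ?thesis .
  qed
  then show ?thesis unfolding hilbert_series_def by simp
qed

section \<open>Krull dimension of edge ideals\<close>

lemma zero_FactRing: "\<zero>\<^bsub>R Quot I\<^esub> = I"
  by (simp add: FactRing_def)

text \<open>Primes of the quotient correspond to the primes above \<open>I\<close>, by preimage and by image.\<close>

lemma quotient_prime_chain_iff:
  fixes R (structure)
  assumes R: "cring R" and I: "ideal I R"
  shows "(\<exists>P. (\<forall>i\<le>n. primeideal (P i) (R Quot I)) \<and> (\<forall>i<n. P i \<subset> P (Suc i)))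
    \<longleftrightarrow> (\<exists>P. (\<forall>i\<le>n. primeideal (P i) R \<and> I \<subseteq> P i) \<and> (\<forall>i<n. P i \<subset> P (Suc i)))" (is "?Quot \<longleftrightarrow> ?R")
proof
  interpret cring R by (rule R)
  interpret h: ring_hom_ring R "R Quot I" "(+>) I" by (rule ideal.rcos_ring_hom_ring[OF I])
  have carrier_quot: "\<exists>r\<in>carrier R. X = I +> r" if "X \<in> carrier (R Quot I)" for X
    using that unfolding FactRing_def A_RCOSETS_def' by auto
  {
    assume ?Quot
    then obtain P where prime: "\<And>i. i \<le> n \<Longrightarrow> primeideal (P i) (R Quot I)"
      and strict: "\<And>i. i < n \<Longrightarrow> P i \<subset> P (Suc i)" by blast
    define Q where "Q i = {r \<in> carrier R. I +> r \<in> P i}" for i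
    have "primeideal (Q i) R" if "i \<le> n" for i
      unfolding Q_def by (rule h.primeideal_vimage[OF R prime[OF that]])
    moreover have "I \<subseteq> Q i" if "i \<le> n" for i
    proof
      fix r assume r: "r \<in> I"
      then have "I +> r = \<zero>\<^bsub>R Quot I\<^esub>" unfolding zero_FactRing by (rule a_rcos_zero[OF I])
      moreover have "\<zero>\<^bsub>R Quot I\<^esub> \<in> P i"
        using prime[OF that] by (intro additive_subgroup.zero_closed ideal.axioms(1) primeideal.axioms(1))
      moreover have "r \<in> carrier R" using r ideal.Icarr[OF I] by blast
      ultimately show "r \<in> Q i" by (simp add: Q_def)
    qed
    moreover have "Q i \<subset> Q (Suc i)" if i: "i < n" for i
    proof -
      obtain X where X: "X \<in> P (Suc i)" "X \<notin> P i" using strict[OF i] by blast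
      have "ideal (P (Suc i)) (R Quot I)" using prime[of "Suc i"] i by (simp add: primeideal.axioms(1))
      then have "X \<in> carrier (R Quot I)" using X(1) ideal.Icarr by metis
      then obtain r where "r \<in> carrier R" "X = I +> r" using carrier_quot by blast
      then have "r \<in> Q (Suc i) - Q i" using X by (simp add: Q_def)
      then show ?thesis using strict[OF i] unfolding Q_def by blast
    qed
    ultimately show ?R by (intro exI[of _ Q]) blast
  }
  {
    assume ?R
    then obtain P where prime: "\<And>i. i \<le> n \<Longrightarrow> primeideal (P i) R"
      and I_sub: "\<And>i. i \<le> n \<Longrightarrow> I \<subseteq> P i"
      and strict: "\<And>i. i < n \<Longrightarrow> P i \<subset> P (Suc i)" by blast
    have mem: "I +> r \<in> (+>) I ` P i \<longleftrightarrow> r \<in> P i" if i: "i \<le> n" and r: "r \<in> carrier R" for i r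
    proof
      assume "I +> r \<in> (+>) I ` P i"
      then obtain s where s: "s \<in> P i" "I +> r = I +> s" by blast
      have Pi: "ideal (P i) R" using prime[OF i] by (rule primeideal.axioms(1))
      then have sR: "s \<in> carrier R" using s(1) ideal.Icarr by metis
      have "r \<ominus> s \<in> I" using quotient_eq_iff_same_a_r_cos[OF I r sR] s(2) by blast
      then have "(r \<ominus> s) \<oplus> s \<in> P i"
        using I_sub[OF i] s(1) additive_subgroup.a_closed[OF ideal.axioms(1)[OF Pi]] by blast
      moreover have "(r \<ominus> s) \<oplus> s = r" using r sR by algebra
      ultimately show "r \<in> P i" by simp
    qed blast
    define Q where "Q i = (+>) I ` P i" for i
    have "primeideal (Q i) (R Quot I)" if i: "i \<le> n" for i
    proof (rule primeidealI)
      have Pi: "ideal (P i) R" using prime[OF i] by (rule primeideal.axioms(1))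
      show "ideal (Q i) (R Quot I)"
        unfolding Q_def by (rule ring_ideal_imp_quot_ideal[OF I Pi])
      show "cring (R Quot I)" by (rule ideal.quotient_is_cring[OF I R])
      have "\<one> \<notin> P i" using primeideal.I_notcarr[OF prime[OF i]] ideal.one_imp_carrier[OF Pi] by blast
      then have "\<one>\<^bsub>R Quot I\<^esub> \<notin> Q i"
        using mem[OF i one_closed] h.hom_one by (simp add: Q_def)
      then show "carrier (R Quot I) \<noteq> Q i" using h.S.one_closed by blast
      fix X Y assume X: "X \<in> carrier (R Quot I)" and Y: "Y \<in> carrier (R Quot I)"
        and XY: "X \<otimes>\<^bsub>R Quot I\<^esub> Y \<in> Q i"
      obtain a b where a: "a \<in> carrier R" "X = I +> a" and b: "b \<in> carrier R" "Y = I +> b"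
        using carrier_quot[OF X] carrier_quot[OF Y] by blast
      have "a \<otimes> b \<in> P i"
        using XY mem[OF i m_closed[OF a(1) b(1)]] h.hom_mult[OF a(1) b(1)] a b by (simp add: Q_def)
      then have "a \<in> P i \<or> b \<in> P i" using primeideal.I_prime[OF prime[OF i] a(1) b(1)] by blast
      then show "X \<in> Q i \<or> Y \<in> Q i" using a b by (auto simp: Q_def)
    qed
    moreover have "Q i \<subset> Q (Suc i)" if i: "i < n" for i
    proof -
      obtain r where r: "r \<in> P (Suc i)" "r \<notin> P i" using strict[OF i] by blast
      have "ideal (P (Suc i)) R" using prime[of "Suc i"] i by (simp add: primeideal.axioms(1))
      then have "r \<in> carrier R" using r(1) ideal.Icarr by metis
      then have "I +> r \<in> Q (Suc i)" "I +> r \<notin> Q i"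
        using r mem[of i r] i unfolding Q_def by auto
      moreover have "Q i \<subseteq> Q (Suc i)" using strict[OF i] unfolding Q_def by blast
      ultimately show ?thesis by blast
    qed
    ultimately show ?Quot by (intro exI[of _ Q]) blast
  }
qed

lemma primeideal_poly_ringD:
  fixes P :: "('v, 'k::field) mpoly set"
  assumes P: "primeideal P (poly_ring V)"
  shows "P \<subseteq> carrier (poly_ring V)" "0 \<in> P" "1 \<notin> P"
    "\<And>p q. p \<in> P \<Longrightarrow> q \<in> P \<Longrightarrow> p - q \<in> P"
    "\<And>p q. p \<in> carrier (poly_ring V) \<Longrightarrow> q \<in> P \<Longrightarrow> p * q \<in> P"
    "\<And>p q. p \<in> carrier (poly_ring V) \<Longrightarrow> q \<in> carrier (poly_ring V) \<Longrightarrow> p * q \<in> P \<Longrightarrow> p \<in> P \<or> q \<in> P"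
proof -
  have I: "ideal P (poly_ring V)" using P by (rule primeideal.axioms(1))
  have A: "additive_subgroup P (poly_ring V)" using I by (rule ideal.axioms(1))
  show carr: "P \<subseteq> carrier (poly_ring V)" using ideal.Icarr[OF I] by blast
  show "0 \<in> P" using additive_subgroup.zero_closed[OF A] by simp
  show "1 \<notin> P"
    using primeideal.I_notcarr[OF P] ideal.one_imp_carrier[OF I] by auto
  show mult: "p * q \<in> P" if "p \<in> carrier (poly_ring V)" "q \<in> P" for p q
    using ideal.I_l_closed[OF I that(2,1)] by simp
  show "p - q \<in> P" if "p \<in> P" "q \<in> P" for p q
  proof -
    have "const (- 1) * q \<in> P" using that by (intro mult) simp_all
    moreover have "const (- 1) * q = - q"
      by (simp add: const_def single_uminus)
    ultimately show ?thesis using additive_subgroup.a_closed[OF A that(1)] by force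
  qed
  show "p \<in> P \<or> q \<in> P" if "p \<in> carrier (poly_ring V)" "q \<in> carrier (poly_ring V)" "p * q \<in> P" for p q
    using primeideal.I_prime[OF P that(1,2)] that(3) by simp
qed

lemma poly_ring_power_closed:
  "p \<in> carrier (poly_ring V) \<Longrightarrow> p ^ n \<in> carrier (poly_ring V)"
  by (induction n) (simp_all add: poly_ring_closed, simp add: poly_ring_carrier_iff)

lemma poly_ring_sum_closed:
  "(\<And>a. a \<in> A \<Longrightarrow> g a \<in> carrier (poly_ring V)) \<Longrightarrow> sum g A \<in> carrier (poly_ring V)"
  by (induction A rule: infinite_finite_induct)
    (simp_all add: poly_ring_closed, simp_all add: poly_ring_carrier_iff)

lemma poly_ring_prod_closed:
  "(\<And>a. a \<in> A \<Longrightarrow> g a \<in> carrier (poly_ring V)) \<Longrightarrow> prod g A \<in> carrier (poly_ring V)"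
  by (induction A rule: infinite_finite_induct)
    (simp_all add: poly_ring_closed, simp_all add: poly_ring_carrier_iff)

text \<open>The coefficients \<open>g j\<close> of a relation in powers of \<open>f\<close> vanish one after the other: modulo \<open>P'\<close> only \<open>g 0\<close>
is left, so \<open>g 0\<close> lies in \<open>P'\<close> and is zero; then \<open>f\<close> can be cancelled because it is not in the prime
\<open>P\<close>, and the relation has become shorter.\<close>

lemma powers_independent_mod_prime:
  fixes P P' :: "('v, 'k::field) mpoly set"
  assumes P: "primeideal P (poly_ring V)" and P': "primeideal P' (poly_ring V)"
    and "P \<subseteq> P'" "f \<in> P'" "f \<notin> P"
  shows "(\<And>j. j < k \<Longrightarrow> g j \<in> carrier (poly_ring V)) \<Longrightarrow> (\<And>j. j < k \<Longrightarrow> g j \<in> P' \<Longrightarrow> g j = 0)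
    \<Longrightarrow> (\<Sum>j<k. f ^ j * g j) \<in> P \<Longrightarrow> j < k \<Longrightarrow> g j = 0"
proof (induction k arbitrary: g j)
  case (Suc k)
  note D = primeideal_poly_ringD[OF P] and D' = primeideal_poly_ringD[OF P']
  have f: "f \<in> carrier (poly_ring V)" using D'(1) \<open>f \<in> P'\<close> by blast
  define r where "r = (\<Sum>j<k. f ^ j * g (Suc j))"
  have r: "r \<in> carrier (poly_ring V)"
    unfolding r_def using Suc.prems(1) f
    by (intro poly_ring_sum_closed poly_ring_closed poly_ring_power_closed) auto
  have split: "(\<Sum>j<Suc k. f ^ j * g j) = g 0 + f * r"
    unfolding sum.lessThan_Suc_shift r_def by (simp add: sum_distrib_left mult.assoc)
  have "r * f \<in> P'" using D'(5)[OF r \<open>f \<in> P'\<close>] .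
  moreover have "g 0 + f * r \<in> P'" using Suc.prems(3) split \<open>P \<subseteq> P'\<close> by auto
  ultimately have "g 0 \<in> P'" using D'(4) by (metis add_diff_cancel_right' mult.commute)
  then have g0: "g 0 = 0" using Suc.prems(2) by blast
  then have "f * r \<in> P" using Suc.prems(3) split by simp
  then have "r \<in> P" using D(6)[OF f r] \<open>f \<notin> P\<close> by blast
  then have "g (Suc i) = 0" if "i < k" for i
    using Suc.IH[of "\<lambda>j. g (Suc j)" i] Suc.prems(1,2) that unfolding r_def by simp
  then show ?case using g0 Suc.prems(4) by (cases j) auto
qed simp

text \<open>Elements picked from the successive steps of a chain of primes are algebraically independent modulo
the smallest one. A polynomial in them is read as a polynomial in the first, whose coefficients are
controlled by the shorter chain that starts at the second prime.\<close>

lemma prime_chain_independent: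
  fixes P :: "nat \<Rightarrow> ('v, 'k::field) mpoly set" and c :: "nat list \<Rightarrow> 'k"
  shows "(\<And>i. i \<le> n \<Longrightarrow> primeideal (P i) (poly_ring V)) \<Longrightarrow> (\<And>i. i < n \<Longrightarrow> P i \<subseteq> P (Suc i))
    \<Longrightarrow> (\<And>i. i < n \<Longrightarrow> f i \<in> P (Suc i) \<and> f i \<notin> P i)
    \<Longrightarrow> (\<Sum>a\<in>{a. set a \<subseteq> {..s} \<and> length a = n}. const (c a) * (\<Prod>i<n. f i ^ (a ! i))) \<in> P 0
    \<Longrightarrow> set a \<subseteq> {..s} \<Longrightarrow> length a = n \<Longrightarrow> c a = 0"
proof (induction n arbitrary: P f c a)
  case 0
  note D = primeideal_poly_ringD[OF 0(1)[OF order_refl]]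
  have "{a. set a \<subseteq> {..s} \<and> length a = 0} = {[]}" by auto
  then have "const (c []) \<in> P 0" using 0(4) by simp
  then have "const (inverse (c [])) * const (c []) \<in> P 0" using D(5) by simp
  moreover have "const (inverse (c [])) * const (c []) = (1 :: ('v, 'k) mpoly)" if "c [] \<noteq> 0"
    using that by (simp add: const_def mult_single)
  ultimately have "c [] = 0" using D(3) by metis
  then show ?case using 0 by simp
next
  case (Suc n)
  let ?L = "{a. set a \<subseteq> {..s} \<and> length a = n}"
  let ?g = "\<lambda>a. \<Prod>i<n. f (Suc i) ^ (a ! i)"
  \<comment> \<open>the coefficient of the \<open>j\<close>-th power of \<open>f 0\<close>\<close>
  define G where "G j = (\<Sum>a\<in>?L. const (c (j # a)) * ?g a)" for j
  have fC: "f i \<in> carrier (poly_ring V)" if "i < Suc n" for i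
    using Suc.prems(3)[OF that] primeideal_poly_ringD(1)[OF Suc.prems(1)[of "Suc i"]] that by auto
  have GC: "G j \<in> carrier (poly_ring V)" for j
    unfolding G_def
    by (intro poly_ring_sum_closed poly_ring_closed poly_ring_prod_closed poly_ring_power_closed
        const_in_carrier fC) simp
  have c_zero: "c (j # a) = 0" if "G j \<in> P 1" "a \<in> ?L" for j a
  proof (rule Suc.IH[of "\<lambda>i. P (Suc i)" "\<lambda>i. f (Suc i)" "\<lambda>a. c (j # a)"])
    show "(\<Sum>a\<in>?L. const (c (j # a)) * ?g a) \<in> P (Suc 0)"
      using that(1) by (simp add: G_def)
  qed (use Suc.prems that(2) in simp_all)
  have G_zero: "G j = 0" if "G j \<in> P 1" for j
    unfolding G_def by (rule sum.neutral) (use c_zero[OF that] in \<open>simp add: const_def\<close>)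
  have inj: "inj_on (\<lambda>(a, j). j # a) (?L \<times> {..s})" by (auto simp: inj_on_def)
  have "(\<Sum>a\<in>{a. set a \<subseteq> {..s} \<and> length a = Suc n}. const (c a) * (\<Prod>i<Suc n. f i ^ (a ! i)))
    = (\<Sum>(a, j)\<in>?L \<times> {..s}. const (c (j # a)) * (\<Prod>i<Suc n. f i ^ ((j # a) ! i)))"
    unfolding lists_length_Suc_eq by (subst sum.reindex[OF inj]) (simp add: case_prod_unfold)
  also have "\<dots> = (\<Sum>(a, j)\<in>?L \<times> {..s}. f 0 ^ j * (const (c (j # a)) * ?g a))"
    by (rule sum.cong) (auto simp: prod.lessThan_Suc_shift mult_ac simp del: prod.lessThan_Suc)
  also have "\<dots> = (\<Sum>j\<in>{..s}. \<Sum>a\<in>?L. f 0 ^ j * (const (c (j # a)) * ?g a))"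
    unfolding sum.cartesian_product[symmetric] by (rule sum.swap)
  also have "\<dots> = (\<Sum>j<Suc s. f 0 ^ j * G j)"
    unfolding G_def lessThan_Suc_atMost by (simp add: sum_distrib_left)
  finally have *: "(\<Sum>j<Suc s. f 0 ^ j * G j) \<in> P 0" using Suc.prems(4) by simp
  have "G j = 0" if "j < Suc s" for j
    by (rule powers_independent_mod_prime[of "P 0" V "P 1" "f 0" "Suc s" G])
      (use Suc.prems(1)[of 0] Suc.prems(1)[of 1] Suc.prems(2)[of 0] Suc.prems(3)[of 0] GC G_zero * that in auto)
  moreover obtain j a' where a: "a = j # a'" using Suc.prems(6) by (cases a) auto
  moreover have "0 \<in> P 1" using primeideal_poly_ringD(2)[OF Suc.prems(1)[of 1]] by simp
  ultimately show ?case
    using c_zero[of j a'] Suc.prems(5,6) by simp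
qed

lemma (in vector_space) card_le_of_independent_family:
  assumes "finite A" "finite T" "g ` A \<subseteq> span T"
    and indep: "\<And>c. (\<Sum>a\<in>A. scale (c a) (g a)) = 0 \<Longrightarrow> \<forall>a\<in>A. c a = 0"
  shows "card A \<le> card T"
proof -
  have inj: "inj_on g A"
  proof (rule inj_onI, rule ccontr)
    fix a b assume ab: "a \<in> A" "b \<in> A" "g a = g b" "a \<noteq> b"
    let ?c = "\<lambda>i. if i = a then 1 else if i = b then - 1 else 0"
    have "(\<Sum>i\<in>A. scale (?c i) (g i)) = (\<Sum>i\<in>{a, b}. scale (?c i) (g i))"
      by (rule sum.mono_neutral_right) (use assms(1) ab in auto)
    also have "\<dots> = 0" using ab by simp
    finally show False using indep[of ?c] ab by auto
  qed
  have "independent (g ` A)"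
  proof
    assume "dependent (g ` A)"
    then obtain u where u: "\<exists>v\<in>g ` A. u v \<noteq> 0" "(\<Sum>v\<in>g ` A. scale (u v) v) = 0"
      using dependent_finite[of "g ` A"] assms(1) by auto
    then have "(\<Sum>a\<in>A. scale (u (g a)) (g a)) = 0"
      using sum.reindex[OF inj, of "\<lambda>v. scale (u v) v"] by simp
    then have "\<forall>a\<in>A. u (g a) = 0" by (rule indep)
    then show False using u(1) by blast
  qed
  then have "card (g ` A) \<le> card T"
    using independent_span_bound[OF assms(2) _ assms(3)] by blast
  then show ?thesis by (simp add: card_image[OF inj])
qed

lemma monom_deg_eq_sum:
  "finite U \<Longrightarrow> Poly_Mapping.keys m \<subseteq> U \<Longrightarrow> monom_deg m = (\<Sum>v\<in>U. Poly_Mapping.lookup m v)"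
  unfolding monom_deg_def by (rule sum.mono_neutral_left) (auto simp: in_keys_iff)

lemma monom_deg_add: "monom_deg (m + n) = monom_deg m + monom_deg n"
proof -
  let ?U = "Poly_Mapping.keys m \<union> Poly_Mapping.keys n"
  have "monom_deg (m + n) = (\<Sum>v\<in>?U. Poly_Mapping.lookup (m + n) v)"
    by (rule monom_deg_eq_sum) (simp_all add: Poly_Mapping.keys_add)
  also have "\<dots> = monom_deg m + monom_deg n"
    by (simp add: lookup_add sum.distrib monom_deg_eq_sum[of ?U])
  finally show ?thesis .
qed

definition deg_le :: "('v, 'k::field) mpoly \<Rightarrow> nat \<Rightarrow> bool" where
  "deg_le p D \<longleftrightarrow> (\<forall>m\<in>Poly_Mapping.keys p. monom_deg m \<le> D)"

lemma deg_le_mult: "deg_le p D \<Longrightarrow> deg_le q E \<Longrightarrow> deg_le (p * q) (D + E)"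
  unfolding deg_le_def using keys_mult[of p q] by (fastforce simp: monom_deg_add intro: add_mono)

lemma deg_le_one: "deg_le 1 D"
  by (simp add: deg_le_def monom_deg_def)

lemma deg_le_power: "deg_le p D \<Longrightarrow> deg_le (p ^ n) (n * D)"
  by (induction n) (auto simp: deg_le_one intro!: deg_le_mult)

lemma deg_le_prod: "(\<And>i. i < n \<Longrightarrow> deg_le (g i) D) \<Longrightarrow> deg_le (\<Prod>i<n. g i) (n * D)"
proof (induction n)
  case (Suc n)
  have "deg_le ((\<Prod>i<n. g i) * g n) (n * D + D)" by (intro deg_le_mult Suc) auto
  then show ?case by (simp add: add.commute)
qed (simp add: deg_le_one)

lemma deg_le_mono: "deg_le p D \<Longrightarrow> D \<le> E \<Longrightarrow> deg_le p E"
  unfolding deg_le_def by fastforce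

lemma deg_le_exists: "\<exists>D. deg_le p D"
  unfolding deg_le_def by (intro exI[of _ "\<Sum>m\<in>Poly_Mapping.keys p. monom_deg m"] ballI member_le_sum) auto

text \<open>The case \<open>u = v\<close> is included, so an independent set has no loop vertex.\<close>

definition indep_sets :: "'v loop_graph \<Rightarrow> 'v set set" where
  "indep_sets H = {A. A \<subseteq> verts H \<and> (\<forall>u\<in>A. \<forall>v\<in>A. {u, v} \<notin> edges H)}"

definition indep_number :: "'v loop_graph \<Rightarrow> nat" where
  "indep_number H = Max (card ` indep_sets H)"

lemma indep_number:
  assumes "finite (verts H)"
  shows "finite (indep_sets H)" "A \<in> indep_sets H \<Longrightarrow> card A \<le> indep_number H"
    "\<exists>A\<in>indep_sets H. card A = indep_number H"
proof -
  show fin: "finite (indep_sets H)"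
    by (rule finite_subset[of _ "Pow (verts H)"]) (auto simp: indep_sets_def assms)
  then show "A \<in> indep_sets H \<Longrightarrow> card A \<le> indep_number H"
    by (simp add: indep_number_def)
  have "{} \<in> indep_sets H" by (simp add: indep_sets_def)
  then have "Max (card ` indep_sets H) \<in> card ` indep_sets H" using fin by (intro Max_in) auto
  then show "\<exists>A\<in>indep_sets H. card A = indep_number H" unfolding indep_number_def by auto
qed

text \<open>A standard monomial is determined by its support and by the exponents at the vertices without a
loop, and these vertices of the support form an independent set.\<close>

lemma card_standard_bound:
  assumes V: "finite (verts H)"
  shows "card {m. Poly_Mapping.keys m \<subseteq> verts H \<and> monom_deg m \<le> D \<and> standard H m}
    \<le> 2 ^ card (verts H) * (D + 1) ^ indep_number H" (is "card ?M \<le> _")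
proof -
  define L where "L = {v. {v} \<in> edges H}"
  let ?T = "\<lambda>A. PiE (A - L) (\<lambda>_. {..D})"
  let ?C = "{A. A \<subseteq> verts H \<and> A - L \<in> indep_sets H}"
  let ?enc = "\<lambda>m :: 'a \<Rightarrow>\<^sub>0 nat. (Poly_Mapping.keys m, restrict (Poly_Mapping.lookup m) (Poly_Mapping.keys m - L))"
  have finA: "finite A" if "A \<in> ?C" for A using that V finite_subset by blast
  have finC: "finite ?C" by (rule finite_subset[of _ "Pow (verts H)"]) (auto simp: V)
  have inj: "inj_on ?enc ?M"
  proof (rule inj_onI)
    fix m m' assume m: "m \<in> ?M" and m': "m' \<in> ?M" and eq: "?enc m = ?enc m'"
    then have keys: "Poly_Mapping.keys m = Poly_Mapping.keys m'"
      and res: "restrict (Poly_Mapping.lookup m) (Poly_Mapping.keys m - L)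
        = restrict (Poly_Mapping.lookup m') (Poly_Mapping.keys m' - L)" by auto
    show "m = m'"
    proof (rule poly_mapping_eqI)
      fix v
      consider "v \<notin> Poly_Mapping.keys m" | "v \<in> Poly_Mapping.keys m - L" | "v \<in> Poly_Mapping.keys m" "v \<in> L"
        by blast
      then show "Poly_Mapping.lookup m v = Poly_Mapping.lookup m' v"
      proof cases
        case 1
        then have "v \<notin> Poly_Mapping.keys m'" using keys by simp
        with 1 show ?thesis by (simp add: in_keys_iff)
      next
        case 2
        then show ?thesis using fun_cong[OF res, of v] keys by simp
      next
        case 3
        have loop: "{v, v} \<in> edges H" using 3 by (simp add: L_def)
        have "Poly_Mapping.lookup m v \<le> 1" "Poly_Mapping.lookup m' v \<le> 1"
          using m m' loop unfolding standard_def mem_Collect_eq by presburger+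
        moreover have "Poly_Mapping.lookup m v \<noteq> 0" "Poly_Mapping.lookup m' v \<noteq> 0"
          using 3 keys in_keys_iff by metis+
        ultimately show ?thesis by linarith
      qed
    qed
  qed
  have enc: "?enc ` ?M \<subseteq> Sigma ?C ?T"
  proof
    fix z assume "z \<in> ?enc ` ?M"
    then obtain m where m: "m \<in> ?M" and z: "z = ?enc m" by blast
    have "Poly_Mapping.keys m - L \<in> indep_sets H"
      unfolding indep_sets_def
    proof (intro CollectI conjI ballI)
      show "Poly_Mapping.keys m - L \<subseteq> verts H" using m by blast
      fix u v assume uv: "u \<in> Poly_Mapping.keys m - L" "v \<in> Poly_Mapping.keys m - L"
      show "{u, v} \<notin> edges H"
      proof
        assume e: "{u, v} \<in> edges H"
        then have "u \<noteq> v" using uv by (auto simp: L_def)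
        then have "Poly_Mapping.lookup m u = 0 \<or> Poly_Mapping.lookup m v = 0"
          using m e unfolding standard_def mem_Collect_eq by presburger
        then show False using uv by (simp add: in_keys_iff)
      qed
    qed
    moreover have "Poly_Mapping.lookup m v \<le> D" for v
      using order_trans[OF lookup_le_monom_deg[of m v]] m by blast
    ultimately show "z \<in> Sigma ?C ?T" using m z by (auto simp: PiE_def)
  qed
  have finT: "finite (?T A)" if "A \<in> ?C" for A
    using finA[OF that] by (intro finite_PiE finite_Diff finite_atMost)
  have cardT: "card (?T A) = (D + 1) ^ card (A - L)" if "A \<in> ?C" for A
    using finA[OF that] by (subst card_PiE) simp_all
  have "card ?M = card (?enc ` ?M)" by (rule card_image[OF inj, symmetric])
  also have "\<dots> \<le> card (Sigma ?C ?T)"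
    by (rule card_mono[OF finite_SigmaI[OF finC finT] enc])
  also have "\<dots> = (\<Sum>A\<in>?C. card (?T A))"
    by (rule card_SigmaI[OF finC]) (intro ballI finT)
  also have "\<dots> = (\<Sum>A\<in>?C. (D + 1) ^ card (A - L))"
    by (rule sum.cong[OF refl cardT])
  also have "\<dots> \<le> (\<Sum>A\<in>?C. (D + 1) ^ indep_number H)"
  proof (intro sum_mono power_increasing)
    fix A assume "A \<in> ?C"
    then show "card (A - L) \<le> indep_number H" by (intro indep_number(2)[OF V]) simp
  qed simp
  also have "\<dots> = card ?C * (D + 1) ^ indep_number H" by simp
  also have "\<dots> \<le> card (Pow (verts H)) * (D + 1) ^ indep_number H"
    by (intro mult_right_mono card_mono) (auto simp: V)
  finally show ?thesis by (simp add: card_Pow[OF V])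
qed

text \<open>Products of powers of the chosen elements, reduced to their standard part, are linearly independent
in a space whose dimension grows at most like the power of \<open>s\<close> given by the independence number.\<close>

lemma prime_chain_length_le:
  fixes H :: "'v loop_graph" and P :: "nat \<Rightarrow> ('v, 'k::field) mpoly set"
  assumes H: "finite_loop_graph H"
    and prime: "\<And>i. i \<le> n \<Longrightarrow> primeideal (P i) (poly_ring (verts H))"
    and J: "edge_ideal H \<subseteq> P 0"
    and strict: "\<And>i. i < n \<Longrightarrow> P i \<subset> P (Suc i)"
  shows "n \<le> indep_number H"
proof -
  let ?V = "verts H" and ?d = "indep_number H"
  have V: "finite ?V" using H by (simp add: finite_loop_graph_def)
  have "\<forall>i. \<exists>p. i < n \<longrightarrow> p \<in> P (Suc i) \<and> p \<notin> P i" using strict by blast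
  then obtain f where f: "\<And>i. i < n \<Longrightarrow> f i \<in> P (Suc i) \<and> f i \<notin> P i" by metis
  have fC: "f i \<in> carrier (poly_ring ?V)" if "i < n" for i
    using f[OF that] primeideal_poly_ringD(1)[OF prime[of "Suc i"]] that by auto
  have "\<forall>i. \<exists>D. deg_le (f i) D" by (intro allI deg_le_exists)
  from choice[OF this] obtain e0 where e0: "\<And>i. deg_le (f i) (e0 i)" by blast
  define e where "e = (\<Sum>i<n. e0 i)"
  have e: "deg_le (f i) e" if "i < n" for i
    using e0 by (rule deg_le_mono) (unfold e_def, rule member_le_sum, use that in auto)
  interpret vs: vector_space "\<lambda>c p. const c * p :: ('v, 'k) mpoly"
    by unfold_locales (simp_all add: const_def single_add mult_single algebra_simps flip: mult.assoc)
  \<comment> \<open>on \<open>k[V]\<close>, the projection onto the span of the standard monomials, with kernel the edge ideal\<close>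
  define st where "st p = (\<Sum>m\<in>{m \<in> Poly_Mapping.keys p. standard H m}. Poly_Mapping.single m (Poly_Mapping.lookup p m))"
    for p :: "('v, 'k) mpoly"
  have lookup_st: "Poly_Mapping.lookup (st p) m = (if standard H m then Poly_Mapping.lookup p m else 0)"
    for p m by (auto simp: st_def lookup_sum lookup_single when_def sum.delta in_keys_iff)
  have lookup_const: "Poly_Mapping.lookup (const c * p) m = c * Poly_Mapping.lookup p m"
    for c and p :: "('v, 'k) mpoly" and m
  proof -
    have "Poly_Mapping.lookup (const c * p) (0 + m) = Poly_Mapping.lookup (const c :: ('v, 'k) mpoly) 0 * Poly_Mapping.lookup p m"
      by (rule lookup_mult_unique) (auto simp: const_def split: if_splits)
    then show ?thesis by (simp add: const_def)
  qed
  have main: "(s + 1) ^ n \<le> 2 ^ card ?V * (n * (s * e) + 1) ^ ?d" for s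
  proof -
    let ?D = "n * (s * e)"
    let ?A = "{a. set a \<subseteq> {..s} \<and> length a = n}"
    let ?g = "\<lambda>a. \<Prod>i<n. f i ^ (a ! i)"
    let ?M = "{m. Poly_Mapping.keys m \<subseteq> ?V \<and> monom_deg m \<le> ?D \<and> standard H m}"
    have finM: "finite ?M" by (rule finite_subset[OF _ finite_bounded_monoms[OF V, of ?D]]) auto
    have gC: "?g a \<in> carrier (poly_ring ?V)" for a
      by (intro poly_ring_prod_closed poly_ring_power_closed fC) simp
    have "card ?A \<le> card ((monomial :: _ \<Rightarrow> ('v, 'k) mpoly) ` ?M)"
    proof (rule vs.card_le_of_independent_family[where g = "\<lambda>a. st (?g a)"])
      show "finite ?A" by (rule finite_lists_length_eq) simp
      show "finite ((monomial :: _ \<Rightarrow> ('v, 'k) mpoly) ` ?M)" using finM by simp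
      show "(\<lambda>a. st (?g a)) ` ?A \<subseteq> vs.span (monomial ` ?M)"
      proof
        fix p assume "p \<in> (\<lambda>a. st (?g a)) ` ?A"
        then obtain a where a: "a \<in> ?A" and p: "p = st (?g a)" by blast
        have "deg_le (?g a) ?D"
        proof (rule deg_le_prod)
          fix i assume i: "i < n"
          then have "a ! i \<in> {..s}" using a nth_mem[of i a] by blast
          then show "deg_le (f i ^ (a ! i)) (s * e)"
            by (intro deg_le_mono[OF deg_le_power[OF e[OF i]]] mult_right_mono) auto
        qed
        then have keys_M: "m \<in> ?M" if "m \<in> Poly_Mapping.keys (?g a)" "standard H m" for m
          using that gC[of a] unfolding deg_le_def poly_ring_carrier_iff by blast
        show "p \<in> vs.span (monomial ` ?M)"
          unfolding p st_def
        proof (rule vs.span_sum)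
          fix m assume "m \<in> {m \<in> Poly_Mapping.keys (?g a). standard H m}"
          then have "m \<in> ?M" by (intro keys_M) auto
          then have "const (Poly_Mapping.lookup (?g a) m) * monomial m \<in> vs.span (monomial ` ?M)"
            by (intro vs.span_scale vs.span_base imageI)
          then show "Poly_Mapping.single m (Poly_Mapping.lookup (?g a) m) \<in> vs.span (monomial ` ?M)"
            by (simp only: const_mult_monomial)
        qed
      qed
      fix c assume c: "(\<Sum>a\<in>?A. const (c a) * st (?g a)) = 0"
      let ?q = "\<Sum>a\<in>?A. const (c a) * ?g a"
      have q_zero: "Poly_Mapping.lookup ?q m = 0" if "standard H m" for m
      proof -
        have "Poly_Mapping.lookup ?q m = Poly_Mapping.lookup (\<Sum>a\<in>?A. const (c a) * st (?g a)) m"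
          using that by (simp add: lookup_sum lookup_const lookup_st)
        then show ?thesis using c by simp
      qed
      have "Poly_Mapping.keys ?q \<subseteq> {m. \<not> standard H m}"
      proof (intro subsetI CollectI notI)
        fix m assume "m \<in> Poly_Mapping.keys ?q" "standard H m"
        then show False using q_zero[of m] unfolding in_keys_iff by iprover
      qed
      moreover have "?q \<in> carrier (poly_ring ?V)"
        by (intro poly_ring_sum_closed poly_ring_closed gC const_in_carrier)
      ultimately have "?q \<in> monom_ideal ?V {m. \<not> standard H m}"
        unfolding monom_ideal_def by blast
      then have q: "?q \<in> P 0" using J unfolding edge_ideal_eq[OF H] by (rule rev_subsetD)
      show "\<forall>a\<in>?A. c a = 0"
      proof
        fix a assume "a \<in> ?A"
        then show "c a = 0"
          using prime_chain_independent[where P = P and n = n and f = f and c = c and s = s,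
              OF prime psubset_imp_subset[OF strict] f q] by blast
      qed
    qed
    also have "\<dots> \<le> card ?M" by (rule card_image_le[OF finM])
    also have "\<dots> \<le> 2 ^ card ?V * (?D + 1) ^ ?d" by (rule card_standard_bound[OF V])
    finally show ?thesis by (simp add: card_lists_length_eq)
  qed
  show ?thesis
  proof (rule ccontr)
    assume "\<not> ?thesis"
    then have d: "Suc ?d \<le> n" by simp
    \<comment> \<open>If \<open>n\<close> exceeded \<open>d\<close>, the bound would give \<open>(s + 1)\<^sup>d\<^sup>+\<^sup>1 \<le> C (s + 1)\<^sup>d\<close>
      for all \<open>s\<close>; it fails at \<open>s = C\<close>.\<close>
    define C where "C = 2 ^ card ?V * (n * e + 1) ^ ?d"
    have "(C + 1) ^ Suc ?d \<le> (C + 1) ^ n" by (rule power_increasing[OF d]) simp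
    also have "\<dots> \<le> 2 ^ card ?V * (n * (C * e) + 1) ^ ?d" by (rule main)
    also have "\<dots> \<le> 2 ^ card ?V * ((n * e + 1) * (C + 1)) ^ ?d"
      by (intro mult_left_mono power_mono) (simp_all add: algebra_simps)
    also have "\<dots> = C * (C + 1) ^ ?d"
      unfolding power_mult_distrib C_def by (simp only: mult.assoc)
    finally show False by simp
  qed
qed

text \<open>For a largest independent set \<open>A\<close>, the variables outside \<open>A\<close> generate a prime containing the edge
ideal, and adding the variables of \<open>A\<close> one at a time gives a chain of the required length.\<close>

lemma krull_dim_edge_ideal:
  fixes H :: "'v loop_graph"
  assumes H: "finite_loop_graph H"
  shows "krull_dim (poly_ring (verts H) Quot (edge_ideal H :: ('v, 'k::field) mpoly set))
    = enat (indep_number H)"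
proof -
  let ?V = "verts H" and ?d = "indep_number H"
  let ?J = "edge_ideal H :: ('v, 'k) mpoly set"
  have V: "finite ?V" using H by (simp add: finite_loop_graph_def)
  define chain where "chain n \<longleftrightarrow> (\<exists>P :: nat \<Rightarrow> ('v, 'k) mpoly set. (\<forall>i\<le>n. primeideal (P i) (poly_ring ?V) \<and> ?J \<subseteq> P i)
    \<and> (\<forall>i<n. P i \<subset> P (Suc i)))" for n
  have le: "n \<le> ?d" if "chain n" for n
    using that unfolding chain_def using prime_chain_length_le[OF H, of n] by blast
  have "chain ?d"
  proof -
    obtain A where A: "A \<in> indep_sets H" "card A = ?d" using indep_number(3)[OF V] by blast
    have "finite A" using A(1) V finite_subset unfolding indep_sets_def by blast
    from finite_distinct_list[OF this] obtain xs where xs: "set xs = A" "distinct xs" by (elim exE conjE)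
    have len: "length xs = ?d" using distinct_card[OF xs(2)] xs(1) A(2) by simp
    \<comment> \<open>a vertex cover at every stage, growing by one vertex of \<open>A\<close> in each step\<close>
    define S where "S i = (?V - A) \<union> set (take i xs)" for i
    define P where "P i = (var_prime ?V (S i) :: ('v, 'k) mpoly set)" for i
    have J: "?J \<subseteq> P i" for i
    proof -
      have "Poly_Mapping.keys m \<inter> S i \<noteq> {}" if neg: "\<not> standard H m" and mV: "Poly_Mapping.keys m \<subseteq> ?V" for m
      proof -
        obtain u v n where e: "{u, v} \<in> edges H" and "m = Poly_Mapping.single u 1 + Poly_Mapping.single v 1 + n"
          using neg unfolding not_standard_iff by blast
        then have "u \<in> Poly_Mapping.keys m" "v \<in> Poly_Mapping.keys m"
          by (simp_all add: in_keys_iff lookup_add)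
        moreover have "u \<notin> A \<or> v \<notin> A" using A(1) e unfolding indep_sets_def by blast
        ultimately show ?thesis using mV unfolding S_def by blast
      qed
      then show ?thesis
        unfolding P_def var_prime_def edge_ideal_eq[OF H] monom_ideal_def poly_ring_carrier_iff by blast
    qed
    moreover have "P i \<subset> P (Suc i)" if i: "i < ?d" for i
    proof -
      let ?v = "xs ! i"
      have take: "take (Suc i) xs = take i xs @ [?v]" using i len by (simp add: take_Suc_conv_app_nth)
      have "?v \<in> A" using nth_mem[of i xs] i len xs(1) by simp
      moreover have "?v \<notin> set (take i xs)"
        using distinct_take[OF xs(2), of "Suc i"] unfolding take by simp
      ultimately have v: "?v \<notin> S i" "?v \<in> S (Suc i)" "?v \<in> ?V"
        using A(1) take unfolding S_def indep_sets_def by auto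
      have "S i \<subseteq> S (Suc i)" using take unfolding S_def by auto
      then have "P i \<subseteq> P (Suc i)" unfolding P_def var_prime_def monom_ideal_def by blast
      moreover have "monomial (Poly_Mapping.single ?v 1) \<in> P (Suc i) - P i"
        using v unfolding P_def var_prime_def monom_ideal_def by (simp add: poly_ring_carrier_iff)
      ultimately show ?thesis by blast
    qed
    ultimately show ?thesis
      unfolding chain_def by (intro exI[of _ P] conjI allI impI) (auto simp: P_def primeideal_var_prime)
  qed
  then have eq: "{enat n | n. chain n} \<subseteq> {..enat ?d}" "enat ?d \<in> {enat n | n. chain n}"
    using le by auto
  have "krull_dim (poly_ring ?V Quot ?J) = Sup {enat n | n. chain n}"
    unfolding krull_dim_def quotient_prime_chain_iff[OF cring_poly_ring ideal_edge_ideal[OF H]] chain_def ..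
  also have "\<dots> = enat ?d"
    using eq by (intro antisym Sup_least Sup_upper) auto
  finally show ?thesis .
qed

section \<open>The Hilbert series as a sum over supports\<close>

lemma monom_deg_single: "monom_deg (Poly_Mapping.single v i) = i"
  by (simp add: monom_deg_def)

text \<open>Monomials with support \<open>A\<close> and prescribed exponent sets, counted by degree: choosing the exponent of
one vertex and then the rest is a Cauchy product.\<close>

lemma series_of_fixed_support:
  fixes E :: "'v \<Rightarrow> nat set"
  assumes "finite A" and pos: "\<And>v. v \<in> A \<Longrightarrow> 0 \<notin> E v"
  shows "Abs_fps (\<lambda>s. int (card {m. Poly_Mapping.keys m = A \<and> monom_deg m = s
      \<and> (\<forall>v\<in>A. Poly_Mapping.lookup m v \<in> E v)}))
    = (\<Prod>v\<in>A. Abs_fps (\<lambda>i. if i \<in> E v then 1 else 0))"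
  using assms
proof (induction A rule: finite_induct)
  case empty
  have "{m :: 'v \<Rightarrow>\<^sub>0 nat. Poly_Mapping.keys m = {} \<and> monom_deg m = s \<and> (\<forall>v\<in>{}. Poly_Mapping.lookup m v \<in> E v)}
    = (if s = 0 then {0} else {})" for s
    by (auto simp: monom_deg_def)
  then show ?case by (simp add: fps_eq_iff)
next
  case (insert v A)
  let ?S = "\<lambda>A s. {m. Poly_Mapping.keys m = A \<and> monom_deg m = s \<and> (\<forall>v\<in>A. Poly_Mapping.lookup m v \<in> E v)}"
  have fin: "finite (?S A s)" for s
    by (rule finite_subset[OF _ finite_bounded_monoms[OF insert.hyps(1), of s]]) blast
  have IH: "Abs_fps (\<lambda>s. int (card (?S A s))) = (\<Prod>v\<in>A. Abs_fps (\<lambda>i. if i \<in> E v then 1 else 0))"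
    using insert.IH insert.prems by blast
  have card_insert: "card (?S (insert v A) s) = (\<Sum>i\<in>{i\<in>{0..s}. i \<in> E v}. card (?S A (s - i)))" for s
  proof -
    let ?I = "{i\<in>{0..s}. i \<in> E v}"
    let ?f = "\<lambda>(i, m). Poly_Mapping.single v i + m"
    have at_v: "Poly_Mapping.lookup (Poly_Mapping.single v i + m) v = i" if "Poly_Mapping.keys m = A" for i m
    proof -
      have "v \<notin> Poly_Mapping.keys m" using that insert.hyps(2) by simp
      then show ?thesis by (simp add: lookup_add in_keys_iff)
    qed
    have inj: "inj_on ?f (Sigma ?I (\<lambda>i. ?S A (s - i)))"
    proof (rule inj_onI, clarify)
      fix i j :: nat and m n :: "'v \<Rightarrow>\<^sub>0 nat"
      assume mn: "Poly_Mapping.keys n = Poly_Mapping.keys m" "A = Poly_Mapping.keys m"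
        and eq: "Poly_Mapping.single v i + m = Poly_Mapping.single v j + n"
      have "i = j" using at_v[of m i] at_v[of n j] mn eq by metis
      then show "i = j \<and> m = n" using eq by simp
    qed
    have "?S (insert v A) s = ?f ` Sigma ?I (\<lambda>i. ?S A (s - i))"
    proof
      show "?S (insert v A) s \<subseteq> ?f ` Sigma ?I (\<lambda>i. ?S A (s - i))"
      proof
        fix m assume m: "m \<in> ?S (insert v A) s"
        let ?i = "Poly_Mapping.lookup m v"
        define m' where "m' = m - Poly_Mapping.single v ?i"
        have lookup_m': "Poly_Mapping.lookup m' w = (if w = v then 0 else Poly_Mapping.lookup m w)" for w
          by (simp add: m'_def lookup_minus lookup_single when_def)
        have split: "m = Poly_Mapping.single v ?i + m'"
          by (rule poly_mapping_eqI) (simp add: lookup_add lookup_m' lookup_single when_def)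
        have "w \<in> Poly_Mapping.keys m' \<longleftrightarrow> w \<in> Poly_Mapping.keys m \<and> w \<noteq> v" for w
          by (simp add: in_keys_iff lookup_m')
        then have "Poly_Mapping.keys m' = A" using m insert.hyps(2) by blast
        moreover have deg: "monom_deg m = ?i + monom_deg m'"
          using arg_cong[OF split, of monom_deg] unfolding monom_deg_add monom_deg_single .
        moreover have "Poly_Mapping.lookup m' w \<in> E w" if "w \<in> A" for w
        proof -
          have "w \<noteq> v" using that insert.hyps(2) by blast
          then have "Poly_Mapping.lookup m' w = Poly_Mapping.lookup m w" by (simp add: lookup_m')
          then show ?thesis using m that by simp
        qed
        moreover have "monom_deg m = s" "?i \<in> E v" using m by blast+
        moreover have "monom_deg m' = s - ?i" "?i \<le> s" using deg calculation by linarith+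
        ultimately have "m' \<in> ?S A (s - ?i)" "?i \<in> ?I" by simp_all
        then have "(?i, m') \<in> Sigma ?I (\<lambda>i. ?S A (s - i))" by (rule SigmaI[rotated])
        then show "m \<in> ?f ` Sigma ?I (\<lambda>i. ?S A (s - i))"
          by (rule rev_image_eqI) (use split in simp)
      qed
      show "?f ` Sigma ?I (\<lambda>i. ?S A (s - i)) \<subseteq> ?S (insert v A) s"
      proof (rule image_subsetI, elim SigmaE)
        fix z i m assume z: "z = (i, m)" and i: "i \<in> ?I" and m: "m \<in> ?S A (s - i)"
        have "i \<noteq> 0" using i insert.prems[of v] by (metis (mono_tags, lifting) insertI1 mem_Collect_eq)
        then have "Poly_Mapping.keys (Poly_Mapping.single v i + m) = insert v A"
          using m by (simp add: keys_add_nat)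
        moreover have "monom_deg (Poly_Mapping.single v i + m) = s"
          using m i by (simp add: monom_deg_add monom_deg_single)
        moreover have "Poly_Mapping.lookup (Poly_Mapping.single v i + m) w \<in> E w" if "w \<in> insert v A" for w
        proof (cases "w = v")
          case True
          then show ?thesis using at_v[of m i] i m by simp
        next
          case False
          then have "Poly_Mapping.lookup (Poly_Mapping.single v i + m) w = Poly_Mapping.lookup m w"
            by (simp add: lookup_add lookup_single_not_eq)
          then show ?thesis using m that False by simp
        qed
        ultimately have "Poly_Mapping.single v i + m \<in> ?S (insert v A) s"
          by (intro CollectI conjI ballI)
        then show "?f z \<in> ?S (insert v A) s" unfolding z by (simp only: prod.case)
      qed
    qed
    then have "card (?S (insert v A) s) = card (Sigma ?I (\<lambda>i. ?S A (s - i)))"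
      using card_image[OF inj] by simp
    also have "\<dots> = (\<Sum>i\<in>?I. card (?S A (s - i)))"
      by (rule card_SigmaI) (simp, intro ballI fin)
    finally show ?thesis .
  qed
  have "Abs_fps (\<lambda>s. int (card (?S (insert v A) s)))
    = Abs_fps (\<lambda>i. if i \<in> E v then 1 else 0) * Abs_fps (\<lambda>s. int (card (?S A s)))"
  proof (rule fps_ext)
    fix s
    have "(\<Sum>i=0..s. (if i \<in> E v then 1 else 0) * int (card (?S A (s - i))))
      = (\<Sum>i=0..s. if i \<in> E v then int (card (?S A (s - i))) else 0)"
      by (rule sum.cong) auto
    also have "\<dots> = (\<Sum>i\<in>{i\<in>{0..s}. i \<in> E v}. int (card (?S A (s - i))))"
      by (rule sum.inter_filter[symmetric]) simp
    finally show "fps_nth (Abs_fps (\<lambda>s. int (card (?S (insert v A) s)))) s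
      = fps_nth (Abs_fps (\<lambda>i. if i \<in> E v then 1 else 0) * Abs_fps (\<lambda>s. int (card (?S A s)))) s"
      unfolding fps_mult_nth fps_nth_Abs_fps card_insert by simp
  qed
  then show ?case unfolding IH using insert.hyps by simp
qed

text \<open>The possible supports of standard monomials. In contrast to independent sets, loop vertices may occur,
since a loop only limits the exponent of its vertex.\<close>

definition semi_indep :: "'v loop_graph \<Rightarrow> 'v set set" where
  "semi_indep H = {A. A \<subseteq> verts H \<and> (\<forall>u\<in>A. \<forall>v\<in>A. u \<noteq> v \<longrightarrow> {u, v} \<notin> edges H)}"

text \<open>The series of the positive exponents that a vertex may have in a standard monomial: \<open>t\<close> at a loop,
and \<open>t/(1 - t)\<close> elsewhere.\<close>

definition var_series :: "'v loop_graph \<Rightarrow> 'v \<Rightarrow> int fps" where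
  "var_series H v = Abs_fps (\<lambda>i. if i \<in> {i. 0 < i \<and> ({v} \<in> edges H \<longrightarrow> i \<le> 1)} then 1 else 0)"

lemma var_series_loop: "{v} \<in> edges H \<Longrightarrow> var_series H v = fps_X"
  by (auto simp: var_series_def fps_X_def fps_eq_iff)

lemma var_series_no_loop: "{v} \<notin> edges H \<Longrightarrow> var_series H v * (1 - fps_X) = fps_X"
  by (rule fps_ext) (simp add: var_series_def right_diff_distrib fps_X_nth)

lemma finite_semi_indep: "finite (verts H) \<Longrightarrow> finite (semi_indep H)"
  by (rule finite_subset[of _ "Pow (verts H)"]) (auto simp: semi_indep_def)

lemma standard_iff_support:
  "Poly_Mapping.keys m \<subseteq> verts H \<and> standard H m \<longleftrightarrow>
    Poly_Mapping.keys m \<in> semi_indep H \<and>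
    (\<forall>v\<in>Poly_Mapping.keys m. Poly_Mapping.lookup m v \<in> {i. 0 < i \<and> ({v} \<in> edges H \<longrightarrow> i \<le> 1)})"
  (is "?L \<longleftrightarrow> ?R")
proof
  assume L: ?L
  show ?R
    unfolding semi_indep_def
  proof (intro conjI CollectI ballI impI)
    show "Poly_Mapping.keys m \<subseteq> verts H" using L by blast
    show "{u, v} \<notin> edges H"
      if uv: "u \<in> Poly_Mapping.keys m" "v \<in> Poly_Mapping.keys m" "u \<noteq> v" for u v
    proof
      assume "{u, v} \<in> edges H"
      then have "Poly_Mapping.lookup m u = 0 \<or> Poly_Mapping.lookup m v = 0"
        by (rule standardD(1)[OF conjunct2[OF L] _ uv(3)])
      then show False using uv(1,2) unfolding in_keys_iff by simp
    qed
    show "0 < Poly_Mapping.lookup m v" if "v \<in> Poly_Mapping.keys m" for v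
      using that unfolding in_keys_iff by simp
    show "Poly_Mapping.lookup m v \<le> 1" if "{v} \<in> edges H" for v
      by (rule standardD(2)[OF conjunct2[OF L] that])
  qed
next
  assume R: ?R
  have "if u = v then Poly_Mapping.lookup m u \<le> 1
      else Poly_Mapping.lookup m u = 0 \<or> Poly_Mapping.lookup m v = 0" if e: "{u, v} \<in> edges H" for u v
  proof (cases "u = v")
    case True
    then have "{v} \<in> edges H" using e by simp
    then have "Poly_Mapping.lookup m v \<le> 1" if "v \<in> Poly_Mapping.keys m"
      using R that by blast
    then show ?thesis using True by (cases "v \<in> Poly_Mapping.keys m") (simp_all add: in_keys_iff)
  next
    case False
    then have "u \<notin> Poly_Mapping.keys m \<or> v \<notin> Poly_Mapping.keys m"
      using R e unfolding semi_indep_def by blast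
    then show ?thesis using False by (auto simp: in_keys_iff)
  qed
  then show ?L using R unfolding standard_def semi_indep_def by blast
qed

lemma hilbert_series_edge_ideal:
  fixes H :: "'v loop_graph"
  assumes H: "finite_loop_graph H"
  shows "hilbert_series (verts H) (edge_ideal H :: ('v, 'k::field) mpoly set)
    = (\<Sum>A\<in>semi_indep H. \<Prod>v\<in>A. var_series H v)"
proof -
  have V: "finite (verts H)" using H by (simp add: finite_loop_graph_def)
  let ?E = "\<lambda>v. {i. 0 < i \<and> ({v} \<in> edges H \<longrightarrow> i \<le> 1)}"
  let ?S = "\<lambda>A s. {m. Poly_Mapping.keys m = A \<and> monom_deg m = s \<and> (\<forall>v\<in>A. Poly_Mapping.lookup m v \<in> ?E v)}"
  have finA: "finite A" if "A \<in> semi_indep H" for A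
    using that V finite_subset unfolding semi_indep_def by blast
  have fin: "finite (?S A s)" if "A \<in> semi_indep H" for A s
    by (rule finite_subset[OF _ finite_bounded_monoms[OF finA[OF that], of s]]) blast
  have "int (card {m. Poly_Mapping.keys m \<subseteq> verts H \<and> monom_deg m = s \<and> standard H m})
    = (\<Sum>A\<in>semi_indep H. int (card (?S A s)))" for s
  proof -
    have "{m. Poly_Mapping.keys m \<subseteq> verts H \<and> monom_deg m = s \<and> standard H m} = (\<Union>A\<in>semi_indep H. ?S A s)"
      using standard_iff_support[of _ H] by blast
    moreover have "card (\<Union>A\<in>semi_indep H. ?S A s) = (\<Sum>A\<in>semi_indep H. card (?S A s))"
      by (rule card_UN_disjoint) (use finite_semi_indep[OF V] fin in blast)+
    ultimately show ?thesis by simp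
  qed
  moreover have "\<not> \<not> standard H 0" by (simp add: standard_def)
  then have "hilbert_series (verts H) (edge_ideal H :: ('v, 'k) mpoly set)
    = Abs_fps (\<lambda>s. int (card {m. Poly_Mapping.keys m \<subseteq> verts H \<and> monom_deg m = s \<and> m \<notin> {m. \<not> standard H m}}))"
    unfolding edge_ideal_eq[OF H]
    by (intro hilbert_series_monom_ideal V) (use not_standard_multiple in auto)
  ultimately have "hilbert_series (verts H) (edge_ideal H :: ('v, 'k) mpoly set)
    = Abs_fps (\<lambda>s. \<Sum>A\<in>semi_indep H. int (card (?S A s)))"
    by simp
  also have "\<dots> = (\<Sum>A\<in>semi_indep H. Abs_fps (\<lambda>s. int (card (?S A s))))"
    by (rule fps_ext) (simp add: fps_sum_nth)
  also have "\<dots> = (\<Sum>A\<in>semi_indep H. \<Prod>v\<in>A. var_series H v)"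
    unfolding var_series_def by (intro sum.cong refl series_of_fixed_support finA) auto
  finally show ?thesis .
qed

text \<open>In the sum over supports \<open>A\<close>, the denominator is \<open>1 - t\<close> to the number of vertices of \<open>A\<close> without a
loop. These vertices are independent, so the exponent is at most the independence number.\<close>

lemma h_polynomial_exists:
  fixes H :: "'v loop_graph"
  assumes H: "finite_loop_graph H"
  shows "\<exists>h. hilbert_series (verts H) (edge_ideal H :: ('v, 'k::field) mpoly set) * (1 - fps_X) ^ indep_number H
    = fps_of_poly h"
proof -
  have V: "finite (verts H)" using H by (simp add: finite_loop_graph_def)
  let ?L = "{v. {v} \<in> edges H}" and ?d = "indep_number H"
  have summand: "(\<Prod>v\<in>A. var_series H v) * (1 - fps_X) ^ ?d
    = fps_of_poly ([:0, 1:] ^ card A * (1 - [:0, 1:]) ^ (?d - card (A - ?L)))" if A: "A \<in> semi_indep H" for A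
  proof -
    have finA: "finite A" using A V finite_subset unfolding semi_indep_def by blast
    have "A - ?L \<in> indep_sets H"
      unfolding indep_sets_def
    proof (intro CollectI conjI ballI)
      show "A - ?L \<subseteq> verts H" using A unfolding semi_indep_def by blast
      show "{u, v} \<notin> edges H" if "u \<in> A - ?L" "v \<in> A - ?L" for u v
        using A that unfolding semi_indep_def by (cases "u = v") auto
    qed
    then have le: "card (A - ?L) \<le> ?d" by (rule indep_number(2)[OF V])
    have "(\<Prod>v\<in>A. var_series H v) = (\<Prod>v\<in>A \<inter> ?L. var_series H v) * (\<Prod>v\<in>A - ?L. var_series H v)"
      by (subst prod.Int_Diff[OF finA, of _ ?L]) simp
    also have "(\<Prod>v\<in>A \<inter> ?L. var_series H v) = fps_X ^ card (A \<inter> ?L)"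
      by (simp add: var_series_loop)
    finally have 1: "(\<Prod>v\<in>A. var_series H v) = fps_X ^ card (A \<inter> ?L) * (\<Prod>v\<in>A - ?L. var_series H v)" .
    have "(\<Prod>v\<in>A - ?L. var_series H v) * (1 - fps_X) ^ card (A - ?L)
      = (\<Prod>v\<in>A - ?L. var_series H v * (1 - fps_X))"
      by (simp add: prod.distrib)
    also have "\<dots> = fps_X ^ card (A - ?L)"
      by (simp add: var_series_no_loop)
    finally have 2: "(\<Prod>v\<in>A - ?L. var_series H v) * (1 - fps_X) ^ card (A - ?L) = fps_X ^ card (A - ?L)" .
    have "(1 - fps_X :: int fps) ^ ?d = (1 - fps_X) ^ card (A - ?L) * (1 - fps_X) ^ (?d - card (A - ?L))"
      using le by (simp flip: power_add)
    then have "(\<Prod>v\<in>A. var_series H v) * (1 - fps_X) ^ ?d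
      = fps_X ^ card (A \<inter> ?L) * ((\<Prod>v\<in>A - ?L. var_series H v) * (1 - fps_X) ^ card (A - ?L))
        * (1 - fps_X) ^ (?d - card (A - ?L))"
      unfolding 1 by (simp only: mult.assoc)
    also have "\<dots> = fps_X ^ (card (A \<inter> ?L) + card (A - ?L)) * (1 - fps_X) ^ (?d - card (A - ?L))"
      unfolding 2 by (simp add: power_add)
    also have "card (A \<inter> ?L) + card (A - ?L) = card A"
      by (rule card_Int_Diff[OF finA, symmetric])
    finally show ?thesis
      by (simp add: fps_of_poly_mult fps_of_poly_power fps_of_poly_diff fps_of_poly_fps_X)
  qed
  have "hilbert_series (verts H) (edge_ideal H :: ('v, 'k::field) mpoly set) * (1 - fps_X) ^ ?d
    = (\<Sum>A\<in>semi_indep H. (\<Prod>v\<in>A. var_series H v) * (1 - fps_X) ^ ?d)"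
    unfolding hilbert_series_edge_ideal[OF H] by (rule sum_distrib_right)
  also have "\<dots> = fps_of_poly (\<Sum>A\<in>semi_indep H. [:0, 1:] ^ card A * (1 - [:0, 1:]) ^ (?d - card (A - ?L)))"
    unfolding fps_of_poly_sum by (rule sum.cong[OF refl summand])
  finally show ?thesis by blast
qed

section \<open>Regular edges and the adjacency of neighbours\<close>

text \<open>Taking \<open>a = y\<close> or \<open>b = x\<close> in the condition excludes loops at \<open>x\<close> and \<open>y\<close>, and also \<open>x = y\<close>.\<close>

definition regular_pair :: "'v loop_graph \<Rightarrow> 'v \<Rightarrow> 'v \<Rightarrow> bool" where
  "regular_pair H x y \<longleftrightarrow> {x, y} \<in> edges H \<and>
     (\<forall>a\<in>nbrs H x. \<forall>b\<in>nbrs H y. a \<noteq> b \<and> {a, b} \<in> edges H)"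

text \<open>Among the standard multiples of \<open>m\<close> take one, \<open>n\<close>, that is killed by as many variables as possible. A
monomial in the other variables cannot kill \<open>n\<close>: at the first variable whose product leaves the
standard monomials, the partial product would be killed by more variables than \<open>n\<close>. So the
annihilator of \<open>n\<close> is generated by variables, hence prime, and it contains every variable killing \<open>m\<close>.\<close>

lemma associated_prime_above_standard:
  fixes H :: "'v loop_graph"
  assumes H: "finite_loop_graph H" and m: "standard H m" "Poly_Mapping.keys m \<subseteq> verts H"
  obtains S where "\<And>v. v \<in> verts H \<Longrightarrow> \<not> standard H (m + Poly_Mapping.single v 1) \<Longrightarrow> v \<in> S"
    and "associated_prime (poly_ring (verts H)) (edge_ideal H) (var_prime (verts H) S :: ('v, 'k::field) mpoly set)"
proof -
  let ?V = "verts H"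
  let ?R = "poly_ring ?V :: ('v, 'k) mpoly ring" and ?J = "edge_ideal H :: ('v, 'k) mpoly set"
  have V: "finite ?V" using H by (simp add: finite_loop_graph_def)
  define killers where "killers n = {v \<in> ?V. \<not> standard H (n + Poly_Mapping.single v 1)}" for n
  let ?P = "\<lambda>w. standard H (m + w) \<and> Poly_Mapping.keys w \<subseteq> ?V"
  have "\<exists>w. ?P w \<and> (\<forall>w'. ?P w' \<longrightarrow> card (killers (m + w')) \<le> card (killers (m + w)))"
  proof (rule ex_has_greatest_nat[of ?P 0])
    show "?P 0" using m by simp
    show "\<forall>w. ?P w \<longrightarrow> card (killers (m + w)) < Suc (card ?V)"
      unfolding less_Suc_eq_le by (intro allI impI card_mono[OF V]) (auto simp: killers_def)
  qed
  then obtain w where w: "?P w" and greatest: "\<And>w'. ?P w' \<Longrightarrow> card (killers (m + w')) \<le> card (killers (m + w))"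
    by blast
  define n where "n = m + w"
  have n: "standard H n" "Poly_Mapping.keys n \<subseteq> ?V"
    using w m unfolding n_def keys_add_nat by auto
  let ?S = "killers n"
  have killers_mono: "killers n' \<subseteq> killers (n' + u)" for n' u
  proof
    fix v assume "v \<in> killers n'"
    then have "v \<in> ?V" "\<not> standard H (n' + Poly_Mapping.single v 1 + u)"
      using not_standard_multiple unfolding killers_def by blast+
    then show "v \<in> killers (n' + u)" by (simp add: killers_def add.assoc add.commute[of u])
  qed
  have free: "standard H (n + k)" if "Poly_Mapping.keys k \<subseteq> ?V" "Poly_Mapping.keys k \<inter> ?S = {}" for k
    using that
  proof (induction "monom_deg k" arbitrary: k)
    case 0
    have "Poly_Mapping.lookup k v = 0" for v using lookup_le_monom_deg[of k v] 0(1) by simp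
    then have "k = 0" by (intro poly_mapping_eqI) simp
    then show ?case using n by simp
  next
    case (Suc d)
    have "k \<noteq> 0" using Suc(2) by (auto simp: monom_deg_def)
    then obtain v where v: "v \<in> Poly_Mapping.keys k" by (metis keys_eq_empty ex_in_conv)
    \<comment> \<open>one variable is removed; the shorter product is standard by induction\<close>
    define k' where "k' = k - Poly_Mapping.single v 1"
    have k: "k = k' + Poly_Mapping.single v 1"
      by (rule poly_mapping_eqI) (use v in \<open>auto simp: k'_def lookup_add lookup_minus lookup_single when_def in_keys_iff\<close>)
    have keys: "Poly_Mapping.keys k' \<subseteq> Poly_Mapping.keys k" unfolding k keys_add_nat by blast
    have "monom_deg k' = d"
      using Suc(2) unfolding k monom_deg_add monom_deg_single by simp
    then have std: "standard H (n + k')" using Suc.hyps(1)[of k'] keys Suc.prems by blast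
    have "?P (w + k')"
      using std w keys Suc.prems(1) unfolding keys_add_nat n_def add.assoc by blast
    then have "card (killers (n + k')) \<le> card (killers n)"
      using greatest[of "w + k'"] unfolding n_def add.assoc by blast
    moreover have "finite (killers (n + k'))" using V by (simp add: killers_def)
    ultimately have "killers (n + k') = killers n"
      using killers_mono[of n k'] card_subset_eq[of "killers (n + k')" "killers n"] card_mono le_antisym by metis
    moreover have "v \<notin> killers n" "v \<in> ?V" using v Suc.prems by blast+
    ultimately have "standard H (n + k' + Poly_Mapping.single v 1)" by (auto simp: killers_def)
    then show ?case by (simp add: k add.assoc)
  qed
  have colon: "standard H (k + n) \<longleftrightarrow> Poly_Mapping.keys k \<inter> ?S = {}" if kV: "Poly_Mapping.keys k \<subseteq> ?V" for k
  proof
    assume std: "standard H (k + n)"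
    show "Poly_Mapping.keys k \<inter> ?S = {}"
    proof (rule ccontr)
      assume "Poly_Mapping.keys k \<inter> ?S \<noteq> {}"
      then obtain v where v: "v \<in> Poly_Mapping.keys k" "v \<in> ?S" by blast
      have "k = Poly_Mapping.single v 1 + (k - Poly_Mapping.single v 1)"
        by (rule poly_mapping_eqI) (use v(1) in \<open>auto simp: lookup_add lookup_minus lookup_single when_def in_keys_iff\<close>)
      then have "k + n = n + Poly_Mapping.single v 1 + (k - Poly_Mapping.single v 1)"
        by (metis add.assoc add.commute)
      moreover have "\<not> standard H (n + Poly_Mapping.single v 1)" using v(2) by (simp add: killers_def)
      ultimately show False using std not_standard_multiple by metis
    qed
  qed (use free[OF kV] in \<open>simp add: add.commute\<close>)
  interpret cring ?R by (rule cring_poly_ring)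
  have J: "ideal ?J ?R" by (rule ideal_edge_ideal[OF H])
  interpret h: ring_hom_ring ?R "?R Quot ?J" "(+>\<^bsub>?R\<^esub>) ?J" by (rule ideal.rcos_ring_hom_ring[OF J])
  have nR: "monomial n \<in> carrier ?R" using n(2) by (rule monom_in_carrier)
  have zero_iff: "?J +>\<^bsub>?R\<^esub> p = \<zero>\<^bsub>?R Quot ?J\<^esub> \<longleftrightarrow> p \<in> ?J" if "p \<in> carrier ?R" for p
    unfolding zero_FactRing using a_rcos_zero[OF J] ideal.rcos_const_imp_mem[OF J that] by blast
  have ann: "(?J +>\<^bsub>?R\<^esub> p) \<otimes>\<^bsub>?R Quot ?J\<^esub> (?J +>\<^bsub>?R\<^esub> monomial n) = \<zero>\<^bsub>?R Quot ?J\<^esub>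
    \<longleftrightarrow> p \<in> var_prime ?V ?S" if p: "p \<in> carrier ?R" for p
  proof -
    have pn: "p * monomial n \<in> carrier ?R" using p nR by (rule poly_ring_closed)
    have "(?J +>\<^bsub>?R\<^esub> p) \<otimes>\<^bsub>?R Quot ?J\<^esub> (?J +>\<^bsub>?R\<^esub> monomial n) = ?J +>\<^bsub>?R\<^esub> (p * monomial n)"
      using h.hom_mult[OF p nR] by simp
    then have "(?J +>\<^bsub>?R\<^esub> p) \<otimes>\<^bsub>?R Quot ?J\<^esub> (?J +>\<^bsub>?R\<^esub> monomial n) = \<zero>\<^bsub>?R Quot ?J\<^esub> \<longleftrightarrow> p * monomial n \<in> ?J"
      using zero_iff[OF pn] by simp
    also have "\<dots> \<longleftrightarrow> (\<forall>k\<in>Poly_Mapping.keys p. \<not> standard H (k + n))"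
      unfolding edge_ideal_eq[OF H] monom_ideal_def mem_Collect_eq keys_mult_monomial image_subset_iff
      using pn by simp
    also have "\<dots> \<longleftrightarrow> p \<in> var_prime ?V ?S"
      unfolding var_prime_def monom_ideal_def using p colon unfolding poly_ring_carrier_iff by blast
    finally show ?thesis .
  qed
  have "associated_prime ?R ?J (var_prime ?V ?S)"
    unfolding associated_prime_def
  proof (intro conjI bexI[of _ "?J +>\<^bsub>?R\<^esub> monomial n"])
    show "primeideal (var_prime ?V ?S :: ('v, 'k) mpoly set) ?R" by (rule primeideal_var_prime)
    have "var_prime ?V ?S \<subseteq> carrier ?R" by (auto simp: var_prime_def monom_ideal_def)
    then show "var_prime ?V ?S
      = {g \<in> carrier ?R. (?J +>\<^bsub>?R\<^esub> g) \<otimes>\<^bsub>?R Quot ?J\<^esub> (?J +>\<^bsub>?R\<^esub> monomial n) = \<zero>\<^bsub>?R Quot ?J\<^esub>}"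
      using ann by blast
    show "?J +>\<^bsub>?R\<^esub> monomial n \<in> carrier (?R Quot ?J)" by (rule h.hom_closed[OF nR])
  qed
  moreover have "v \<in> ?S" if "v \<in> ?V" "\<not> standard H (m + Poly_Mapping.single v 1)" for v
    using that killers_mono[of m w] unfolding n_def killers_def by blast
  ultimately show thesis using that by blast
qed

text \<open>If \<open>a\<close> and \<open>b\<close> are equal or not adjacent, their squarefree product is standard and is killed by \<open>x\<close> and
by \<open>y\<close>. An associated prime then contains \<open>x\<close> and \<open>y\<close>, so its square contains \<open>x y\<close>.\<close>

lemma regular_edge_imp_regular_pair:
  fixes H :: "'v loop_graph"
  assumes H: "finite_loop_graph H" and regular: "regular_edge TYPE('k::field) H x y"
  shows "regular_pair H x y"
  unfolding regular_pair_def
proof (intro conjI ballI)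
  have xy: "{x, y} \<in> edges H" using regular by (simp add: regular_edge_def)
  have vs: "u \<in> verts H \<and> v \<in> verts H" if "{u, v} \<in> edges H" for u v
    using H that unfolding finite_loop_graph_def by (metis doubleton_eq_iff)
  show "{x, y} \<in> edges H" by (rule xy)
  fix a b assume "a \<in> nbrs H x" "b \<in> nbrs H y"
  then have ax: "{a, x} \<in> edges H" and b_y: "{b, y} \<in> edges H" by (simp_all add: nbrs_def)
  have "a \<noteq> b \<and> {a, b} \<in> edges H"
  proof (rule ccontr)
    assume neg: "\<not> (a \<noteq> b \<and> {a, b} \<in> edges H)"
    \<comment> \<open>if \<open>a = b\<close>, the product has to be squarefree, since \<open>a\<close> may have a loop\<close>
    define m where "m = (if a = b then Poly_Mapping.single a 1
      else Poly_Mapping.single a 1 + Poly_Mapping.single b (1::nat))"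
    have lookup_m: "Poly_Mapping.lookup m v = (if v = a \<or> v = b then 1 else 0)" for v
      by (auto simp: m_def lookup_add lookup_single when_def)
    have std: "standard H m"
      unfolding standard_def lookup_m using neg by (auto simp: doubleton_eq_iff insert_commute)
    have mV: "Poly_Mapping.keys m \<subseteq> verts H"
      using vs[OF ax] vs[OF b_y] by (auto simp: in_keys_iff lookup_m split: if_splits)
    have killers: "\<not> standard H (m + Poly_Mapping.single v 1)" if e: "{c, v} \<in> edges H" and c: "c = a \<or> c = b" for c v
    proof
      assume s: "standard H (m + Poly_Mapping.single v 1)"
      have "Poly_Mapping.lookup (m + Poly_Mapping.single v 1) c \<noteq> 0"
        "Poly_Mapping.lookup (m + Poly_Mapping.single v 1) v \<noteq> 0"
        "c = v \<Longrightarrow> Poly_Mapping.lookup (m + Poly_Mapping.single v 1) c = 2"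
        using c by (auto simp: lookup_add lookup_m lookup_single when_def)
      then show False using standardD[OF s] e by (cases "c = v") force+
    qed
    obtain S where S: "\<And>v. v \<in> verts H \<Longrightarrow> \<not> standard H (m + Poly_Mapping.single v 1) \<Longrightarrow> v \<in> S"
      and Q: "associated_prime (poly_ring (verts H)) (edge_ideal H) (var_prime (verts H) S :: ('v, 'k) mpoly set)"
      using associated_prime_above_standard[OF H std mV] by metis
    have "x \<in> S" "y \<in> S" using S killers ax b_y vs[OF xy] by blast+
    then have "var x \<in> (var_prime (verts H) S :: ('v, 'k) mpoly set)"
      "var y \<in> (var_prime (verts H) S :: ('v, 'k) mpoly set)"
      using vs[OF xy] by (simp_all add: var_def var_prime_def monom_ideal_def poly_ring_carrier_iff)
    then have "var x * var y \<in> ideal_prod (poly_ring (verts H)) (var_prime (verts H) S :: ('v, 'k) mpoly set) (var_prime (verts H) S)"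
      using ideal_prod.prod[of "var x" _ "var y" _ "poly_ring (verts H)"] by simp
    then show False using regular Q unfolding regular_edge_def by blast
  qed
  then show "a \<noteq> b" "{a, b} \<in> edges H" by blast+
qed

section \<open>Graphs obtained by contracting an edge\<close>

lemma edge_in_verts:
  assumes "finite_loop_graph H" "{u, v} \<in> edges H"
  shows "u \<in> verts H" "v \<in> verts H"
  using assms unfolding finite_loop_graph_def by (metis doubleton_eq_iff)+

lemma regular_pair_commute: "regular_pair H x y \<longleftrightarrow> regular_pair H y x"
proof -
  have "regular_pair H v u" if "regular_pair H u v" for u v
    unfolding regular_pair_def
  proof (intro conjI ballI)
    show "{v, u} \<in> edges H" using that by (simp add: regular_pair_def insert_commute)
    fix a b assume "a \<in> nbrs H v" "b \<in> nbrs H u"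
    then have "b \<noteq> a \<and> {b, a} \<in> edges H" using that unfolding regular_pair_def by blast
    then show "a \<noteq> b" "{a, b} \<in> edges H" by (auto simp: insert_commute)
  qed
  then show ?thesis by blast
qed

lemma regular_pairD:
  assumes "regular_pair H x y"
  shows "x \<noteq> y" "{x, y} \<in> edges H" "{x} \<notin> edges H" "{y} \<notin> edges H"
    and "{a, x} \<in> edges H \<Longrightarrow> {b, y} \<in> edges H \<Longrightarrow> a \<noteq> b \<and> {a, b} \<in> edges H"
proof -
  show e: "{x, y} \<in> edges H" using assms by (simp add: regular_pair_def)
  show R: "a \<noteq> b \<and> {a, b} \<in> edges H" if "{a, x} \<in> edges H" "{b, y} \<in> edges H" for a b
    using assms that unfolding regular_pair_def nbrs_def by blast
  have e': "{y, x} \<in> edges H" using e by (simp add: insert_commute)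
  show "x \<noteq> y" using R[OF e' e] by blast
  show "{x} \<notin> edges H" using R[of x x] e by auto
  show "{y} \<notin> edges H" using R[of y y] e' by auto
qed

text \<open>What the lower and the upper contraction have in common: at every edge with an end \<open>b\<close> outside
\<open>{x, y}\<close>, the vertex \<open>x\<close> has taken over the neighbours of \<open>y\<close>. The two contractions differ only in the
edges inside \<open>{x, y}\<close> and in whether \<open>y\<close> is still a vertex.\<close>

definition contracts :: "'v loop_graph \<Rightarrow> 'v \<Rightarrow> 'v \<Rightarrow> 'v loop_graph \<Rightarrow> bool" where
  "contracts H x y K \<longleftrightarrow> (\<forall>a b. b \<noteq> x \<and> b \<noteq> y \<longrightarrow>
     ({a, b} \<in> edges K \<longleftrightarrow>
       (if a = x then {x, b} \<in> edges H \<or> {y, b} \<in> edges H else a \<noteq> y \<and> {a, b} \<in> edges H)))"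

lemma contractsD:
  assumes "contracts H x y K" "b \<noteq> x" "b \<noteq> y"
  shows "{x, b} \<in> edges K \<longleftrightarrow> {x, b} \<in> edges H \<or> {y, b} \<in> edges H"
    and "x \<noteq> y \<Longrightarrow> {y, b} \<notin> edges K"
    and "a \<noteq> x \<Longrightarrow> a \<noteq> y \<Longrightarrow> {a, b} \<in> edges K \<longleftrightarrow> {a, b} \<in> edges H"
  using assms unfolding contracts_def by auto

lemma edge_lower_edges:
  "e \<in> edges (edge_lower H x y) \<longleftrightarrow>
     (\<exists>a b. e = {a, b} \<and> {a, b} \<in> edges H \<and> a \<noteq> y \<and> b \<noteq> y)
     \<or> (\<exists>a. e = {a, x} \<and> a \<in> verts H \<and> a \<noteq> y \<and> {a, y} \<in> edges H)"
  unfolding edge_lower_def by auto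

lemma edge_upper_edges:
  "e \<in> edges (edge_upper H x y) \<longleftrightarrow>
     (\<exists>a b. e = {a, b} \<and> {a, b} \<in> edges H \<and> a \<noteq> y \<and> b \<noteq> y)
     \<or> (\<exists>a. e = {a, x} \<and> {a, y} \<in> edges H \<and> a \<noteq> x) \<or> e = {x, y}"
  unfolding edge_upper_def by auto

lemma contracts_edge_lower:
  assumes H: "finite_loop_graph H" and xy: "x \<noteq> y"
  shows "contracts H x y (edge_lower H x y)"
  unfolding contracts_def
proof (intro allI impI, elim conjE)
  fix a b assume b: "b \<noteq> x" "b \<noteq> y"
  have 1: "(\<exists>a' b'. {a, b} = {a', b'} \<and> {a', b'} \<in> edges H \<and> a' \<noteq> y \<and> b' \<noteq> y)
    \<longleftrightarrow> a \<noteq> y \<and> {a, b} \<in> edges H"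
    using b by (auto simp: doubleton_eq_iff insert_commute)
  have 2: "(\<exists>a'. {a, b} = {a', x} \<and> a' \<in> verts H \<and> a' \<noteq> y \<and> {a', y} \<in> edges H)
    \<longleftrightarrow> a = x \<and> b \<in> verts H \<and> {b, y} \<in> edges H"
    using b by (auto simp: doubleton_eq_iff)
  have 3: "{b, y} \<in> edges H \<Longrightarrow> b \<in> verts H" using edge_in_verts[OF H] by blast
  show "{a, b} \<in> edges (edge_lower H x y) \<longleftrightarrow>
    (if a = x then {x, b} \<in> edges H \<or> {y, b} \<in> edges H else a \<noteq> y \<and> {a, b} \<in> edges H)"
    unfolding edge_lower_edges 1 2 using 3 xy by (auto simp: insert_commute)
qed

lemma contracts_edge_upper:
  assumes xy: "x \<noteq> y" and no_loop: "{y} \<notin> edges H"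
  shows "contracts H x y (edge_upper H x y)"
  unfolding contracts_def
proof (intro allI impI, elim conjE)
  fix a b assume b: "b \<noteq> x" "b \<noteq> y"
  have 1: "(\<exists>a' b'. {a, b} = {a', b'} \<and> {a', b'} \<in> edges H \<and> a' \<noteq> y \<and> b' \<noteq> y)
    \<longleftrightarrow> a \<noteq> y \<and> {a, b} \<in> edges H"
    using b by (auto simp: doubleton_eq_iff insert_commute)
  have 2: "(\<exists>a'. {a, b} = {a', x} \<and> {a', y} \<in> edges H \<and> a' \<noteq> x)
    \<longleftrightarrow> a = x \<and> {b, y} \<in> edges H"
    using b by (auto simp: doubleton_eq_iff)
  have 3: "{a, b} \<noteq> {x, y}" using b by auto
  show "{a, b} \<in> edges (edge_upper H x y) \<longleftrightarrow>
    (if a = x then {x, b} \<in> edges H \<or> {y, b} \<in> edges H else a \<noteq> y \<and> {a, b} \<in> edges H)"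
    unfolding edge_upper_edges 1 2 using 3 xy by (auto simp: insert_commute)
qed

lemma finite_edge_lower:
  assumes H: "finite_loop_graph H" and reg: "regular_pair H x y"
  shows "finite_loop_graph (edge_lower H x y)"
  unfolding finite_loop_graph_def
proof (intro conjI ballI)
  have V: "verts (edge_lower H x y) = verts H - {y}" by (simp add: edge_lower_def)
  show "finite (verts (edge_lower H x y))" using H by (simp add: V finite_loop_graph_def)
  have x: "x \<in> verts H - {y}" using edge_in_verts[OF H regular_pairD(2)[OF reg]] regular_pairD(1)[OF reg] by blast
  fix e assume "e \<in> edges (edge_lower H x y)"
  then show "\<exists>a\<in>verts (edge_lower H x y). \<exists>b\<in>verts (edge_lower H x y). e = {a, b}"
    unfolding edge_lower_edges
  proof (elim disjE exE conjE)
    fix a b assume "e = {a, b}" "{a, b} \<in> edges H" "a \<noteq> y" "b \<noteq> y"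
    then show ?thesis using edge_in_verts[OF H, of a b] unfolding V by blast
  next
    fix a assume "e = {a, x}" "a \<in> verts H" "a \<noteq> y"
    then show ?thesis using x unfolding V by blast
  qed
qed

lemma finite_edge_upper:
  assumes H: "finite_loop_graph H" and reg: "regular_pair H x y"
  shows "finite_loop_graph (edge_upper H x y)"
  unfolding finite_loop_graph_def
proof (intro conjI ballI)
  have V: "verts (edge_upper H x y) = verts H" by (simp add: edge_upper_def)
  show "finite (verts (edge_upper H x y))" using H by (simp add: V finite_loop_graph_def)
  have xy: "x \<in> verts H" "y \<in> verts H" using edge_in_verts[OF H regular_pairD(2)[OF reg]] by blast+
  fix e assume "e \<in> edges (edge_upper H x y)"
  then show "\<exists>a\<in>verts (edge_upper H x y). \<exists>b\<in>verts (edge_upper H x y). e = {a, b}"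
    unfolding edge_upper_edges
  proof (elim disjE exE conjE)
    fix a b assume "e = {a, b}" "{a, b} \<in> edges H"
    then show ?thesis using edge_in_verts[OF H, of a b] unfolding V by blast
  next
    fix a assume "e = {a, x}" "{a, y} \<in> edges H"
    then show ?thesis using xy edge_in_verts[OF H, of a y] unfolding V by blast
  next
    assume "e = {x, y}"
    then show ?thesis using xy unfolding V by blast
  qed
qed

text \<open>Since \<open>q\<close> is adjacent to neither \<open>x\<close> nor \<open>y\<close>, its neighbours stay the same. A neighbour of \<open>p\<close> in \<open>K\<close> is
a neighbour in \<open>H\<close>, or it is \<open>x\<close> in place of \<open>y\<close>; a neighbour \<open>b\<close> of \<open>q\<close> that is adjacent to \<open>y\<close> in \<open>H\<close> is
adjacent to \<open>x\<close> in \<open>K\<close>, so the adjacency property is inherited.\<close>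

lemma regular_pair_contracts:
  assumes K: "contracts H x y K" and xy: "x \<noteq> y" and reg: "regular_pair H p q"
    and disj: "{x, y} \<inter> {p, q} = {}" and miss: "nbrs H q \<inter> {x, y} = {}"
  shows "regular_pair K p q" "nbrs K q = nbrs H q"
proof -
  have p: "p \<noteq> x" "p \<noteq> y" and q: "q \<noteq> x" "q \<noteq> y" using disj by auto
  have q_miss: "{x, q} \<notin> edges H" "{y, q} \<notin> edges H" using miss by (auto simp: nbrs_def)
  show nb: "nbrs K q = nbrs H q"
  proof (rule Set.set_eqI)
    fix u
    show "u \<in> nbrs K q \<longleftrightarrow> u \<in> nbrs H q"
      using contractsD[OF K q] q_miss xy unfolding nbrs_def by (cases "u = x"; cases "u = y") simp_all
  qed
  show "regular_pair K p q"
    unfolding regular_pair_def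
  proof (intro conjI ballI)
    show "{p, q} \<in> edges K" using contractsD(3)[OF K q p] regular_pairD(2)[OF reg] by simp
    fix a b assume a: "a \<in> nbrs K p" and "b \<in> nbrs K q"
    then have "b \<in> nbrs H q" using nb by simp
    then have bq: "{b, q} \<in> edges H" by (simp add: nbrs_def)
    then have b: "b \<noteq> x" "b \<noteq> y" using q_miss by auto
    have ap: "{a, p} \<in> edges K" using a by (simp add: nbrs_def)
    have "a \<noteq> b \<and> {a, b} \<in> edges K"
    proof (cases "a = x")
      case True
      then have "{x, p} \<in> edges H \<or> {y, p} \<in> edges H" using ap contractsD(1)[OF K p] by simp
      then have "{x, b} \<in> edges H \<or> {y, b} \<in> edges H" using regular_pairD(5)[OF reg _ bq] by blast
      then show ?thesis using True b contractsD(1)[OF K b] by simp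
    next
      case False
      then have ay: "a \<noteq> y" using ap contractsD(2)[OF K p xy] by auto
      then have "{a, p} \<in> edges H" using ap contractsD(3)[OF K p False] by simp
      then show ?thesis using regular_pairD(5)[OF reg _ bq] contractsD(3)[OF K b False ay] by simp
    qed
    then show "a \<noteq> b" "{a, b} \<in> edges K" by blast+
  qed
qed

section \<open>Contraction along a regular edge: Hilbert series and dimension\<close>

text \<open>A support contains at most one of \<open>x\<close> and \<open>y\<close>; the sum is grouped by what is left after removing it. The
vertex \<open>y\<close> may be missing from the graph, so that the formula also covers the lower contraction.\<close>

lemma sum_semi_indep_split:
  fixes w :: "'v \<Rightarrow> int fps"
  assumes V: "finite (verts K)" and x: "x \<in> verts K" and xy: "x \<noteq> y"
    and adj: "y \<in> verts K \<Longrightarrow> {x, y} \<in> edges K"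
  shows "(\<Sum>A\<in>semi_indep K. \<Prod>v\<in>A. w v)
    = (\<Sum>B\<in>{B \<in> semi_indep K. x \<notin> B \<and> y \<notin> B}. (\<Prod>v\<in>B. w v) *
        (1 + (if \<forall>b\<in>B. {x, b} \<notin> edges K then w x else 0)
           + (if y \<in> verts K \<and> (\<forall>b\<in>B. {y, b} \<notin> edges K) then w y else 0)))"
proof -
  let ?I = "{B \<in> semi_indep K. x \<notin> B \<and> y \<notin> B}"
  let ?F = "\<lambda>z. {B \<in> ?I. z \<in> verts K \<and> (\<forall>b\<in>B. {z, b} \<notin> edges K)}"
  have fin: "finite ?I" using finite_semi_indep[OF V] by simp
  have finB: "finite B" if "B \<in> ?I" for B using that V finite_subset unfolding semi_indep_def by blast
  have insert_iff: "insert z B \<in> semi_indep K \<longleftrightarrow> B \<in> ?F z" if "B \<in> ?I" "z \<notin> B" for z B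
    using that unfolding semi_indep_def by (auto simp: insert_commute)
  have decomp: "semi_indep K = ?I \<union> (insert x ` ?F x \<union> insert y ` ?F y)"
  proof
    show "?I \<union> (insert x ` ?F x \<union> insert y ` ?F y) \<subseteq> semi_indep K"
      using insert_iff by blast
    show "semi_indep K \<subseteq> ?I \<union> (insert x ` ?F x \<union> insert y ` ?F y)"
    proof
      fix A assume A: "A \<in> semi_indep K"
      have not_both: "\<not> (x \<in> A \<and> y \<in> A)"
        using A adj xy unfolding semi_indep_def by blast
      have sub: "A - {z} \<in> semi_indep K" for z using A unfolding semi_indep_def by blast
      have mem: "A \<in> insert z ` ?F z" if z: "z \<in> A" "A - {z} \<in> ?I" for z
      proof (rule image_eqI)
        show eq: "A = insert z (A - {z})" using z(1) by blast
        have "insert z (A - {z}) \<in> semi_indep K" unfolding eq[symmetric] by (rule A)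
        then show "A - {z} \<in> ?F z"
          by (subst (asm) insert_iff[OF z(2)]) simp_all
      qed
      show "A \<in> ?I \<union> (insert x ` ?F x \<union> insert y ` ?F y)"
        using mem[of x] mem[of y] sub[of x] sub[of y] A not_both by blast
    qed
  qed
  have part: "(\<Sum>A\<in>insert z ` ?F z. \<Prod>v\<in>A. w v)
    = (\<Sum>B\<in>?I. if z \<in> verts K \<and> (\<forall>b\<in>B. {z, b} \<notin> edges K) then (\<Prod>v\<in>B. w v) * w z else 0)"
    if z: "z = x \<or> z = y" for z
  proof -
    have inj: "inj_on (insert z) (?F z)" using z by (auto simp: inj_on_def)
    have "(\<Sum>A\<in>insert z ` ?F z. \<Prod>v\<in>A. w v) = (\<Sum>B\<in>?F z. \<Prod>v\<in>insert z B. w v)"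
      by (rule sum.reindex_cong[OF inj refl refl])
    also have "\<dots> = (\<Sum>B\<in>?F z. (\<Prod>v\<in>B. w v) * w z)"
    proof (rule sum.cong[OF refl])
      fix B assume B: "B \<in> ?F z"
      then have "finite B" "z \<notin> B" using finB z by blast+
      then show "(\<Prod>v\<in>insert z B. w v) = (\<Prod>v\<in>B. w v) * w z" by (simp add: mult.commute)
    qed
    also have "\<dots> = (\<Sum>B\<in>?I. if z \<in> verts K \<and> (\<forall>b\<in>B. {z, b} \<notin> edges K) then (\<Prod>v\<in>B. w v) * w z else 0)"
      by (rule sum.inter_filter[OF fin])
    finally show ?thesis .
  qed
  have "(\<Sum>A\<in>semi_indep K. \<Prod>v\<in>A. w v) = (\<Sum>A\<in>?I. \<Prod>v\<in>A. w v)
    + ((\<Sum>A\<in>insert x ` ?F x. \<Prod>v\<in>A. w v) + (\<Sum>A\<in>insert y ` ?F y. \<Prod>v\<in>A. w v))"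
  proof -
    have d1: "?I \<inter> (insert x ` ?F x \<union> insert y ` ?F y) = {}" by blast
    have d2: "insert x ` ?F x \<inter> insert y ` ?F y = {}" using xy by blast
    have f: "finite (insert x ` ?F x)" "finite (insert y ` ?F y)"
      by (rule finite_imageI, rule finite_subset[OF _ fin], blast)+
    show ?thesis
      by (subst decomp) (simp only: sum.union_disjoint[OF fin finite_UnI[OF f] d1] sum.union_disjoint[OF f d2])
  qed
  also have "\<dots> = (\<Sum>B\<in>?I. (\<Prod>v\<in>B. w v) *
        (1 + (if \<forall>b\<in>B. {x, b} \<notin> edges K then w x else 0)
           + (if y \<in> verts K \<and> (\<forall>b\<in>B. {y, b} \<notin> edges K) then w y else 0)))"
    unfolding part[OF disjI1[OF refl]] part[OF disjI2[OF refl]] sum.distrib[symmetric]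
    by (rule sum.cong[OF refl]) (use x in \<open>simp add: algebra_simps\<close>)
  finally show ?thesis .
qed

lemma semi_indep_contracts:
  assumes K: "contracts H x y K" and V: "verts K - {x, y} = verts H - {x, y}"
  shows "{B \<in> semi_indep K. x \<notin> B \<and> y \<notin> B} = {B \<in> semi_indep H. x \<notin> B \<and> y \<notin> B}"
    and "B \<in> {B \<in> semi_indep H. x \<notin> B \<and> y \<notin> B} \<Longrightarrow> (\<Prod>v\<in>B. var_series K v) = (\<Prod>v\<in>B. var_series H v)"
proof -
  have e: "{u, v} \<in> edges K \<longleftrightarrow> {u, v} \<in> edges H" if "u \<noteq> x" "u \<noteq> y" "v \<noteq> x" "v \<noteq> y" for u v
    using contractsD(3)[OF K that(3,4,1,2)] .
  have "B \<in> semi_indep K \<longleftrightarrow> B \<in> semi_indep H" if B: "x \<notin> B" "y \<notin> B" for B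
  proof -
    have "B \<subseteq> verts K \<longleftrightarrow> B \<subseteq> verts H" using V B by blast
    moreover have "{u, v} \<in> edges K \<longleftrightarrow> {u, v} \<in> edges H" if "u \<in> B" "v \<in> B" for u v
      by (rule e) (use that B in auto)
    ultimately show ?thesis unfolding semi_indep_def by blast
  qed
  then show "{B \<in> semi_indep K. x \<notin> B \<and> y \<notin> B} = {B \<in> semi_indep H. x \<notin> B \<and> y \<notin> B}" by blast
  show "(\<Prod>v\<in>B. var_series K v) = (\<Prod>v\<in>B. var_series H v)"
    if B: "B \<in> {B \<in> semi_indep H. x \<notin> B \<and> y \<notin> B}" for B
  proof (rule prod.cong[OF refl])
    fix v assume "v \<in> B"
    then have "v \<noteq> x" "v \<noteq> y" using B by auto
    then have "{v} \<in> edges K \<longleftrightarrow> {v} \<in> edges H" using e[of v v] by simp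
    then show "var_series K v = var_series H v" by (simp add: var_series_def)
  qed
qed

lemma semi_indep_free:
  assumes reg: "regular_pair H x y" and B: "B \<in> semi_indep H"
  shows "(\<forall>b\<in>B. {x, b} \<notin> edges H) \<or> (\<forall>b\<in>B. {y, b} \<notin> edges H)"
proof (rule ccontr)
  assume "\<not> ?thesis"
  then obtain a b where "a \<in> B" "{a, x} \<in> edges H" "b \<in> B" "{b, y} \<in> edges H"
    by (auto simp: insert_commute)
  then show False using regular_pairD(5)[OF reg, of a b] B unfolding semi_indep_def by blast
qed

lemma edge_lower_loop: "finite_loop_graph H \<Longrightarrow> regular_pair H x y \<Longrightarrow> {x, x} \<in> edges (edge_lower H x y)"
  using edge_in_verts[of H x y] regular_pairD(1,2)[of H x y] unfolding edge_lower_edges by blast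

lemma edge_upper_loops:
  assumes "regular_pair H x y"
  shows "{x} \<notin> edges (edge_upper H x y)" "{y} \<notin> edges (edge_upper H x y)"
  using regular_pairD[OF assms] unfolding edge_upper_edges
  by (auto simp: doubleton_eq_iff singleton_insert_inj_eq')

text \<open>For each support \<open>B\<close> without \<open>x\<close> and \<open>y\<close>, the factors in the three graphs are compared. With
\<open>q (1 - t) = t\<close>, the lower one reduces to \<open>(1 + q) (1 - t) = 1\<close> and \<open>(1 + 2 q) (1 - t) = 1 + t\<close>.\<close>

lemma hilbert_series_regular_edge:
  fixes H :: "'v loop_graph"
  assumes H: "finite_loop_graph H" and reg: "regular_pair H x y"
  shows "hilbert_series (verts (edge_lower H x y)) (edge_ideal (edge_lower H x y) :: ('v, 'k::field) mpoly set)
      = hilbert_series (verts H) (edge_ideal H :: ('v, 'k) mpoly set) * (1 - fps_X)" (is "?lower")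
    and "hilbert_series (verts (edge_upper H x y)) (edge_ideal (edge_upper H x y) :: ('v, 'k) mpoly set)
      = hilbert_series (verts H) (edge_ideal H :: ('v, 'k) mpoly set)" (is "?upper")
proof -
  let ?Hl = "edge_lower H x y" and ?Hu = "edge_upper H x y"
  note D = regular_pairD[OF reg]
  let ?I = "{B \<in> semi_indep H. x \<notin> B \<and> y \<notin> B}"
  have V: "finite (verts H)" using H by (simp add: finite_loop_graph_def)
  have xV: "x \<in> verts H" "y \<in> verts H" using edge_in_verts[OF H D(2)] by blast+
  have Vl: "verts ?Hl = verts H - {y}" and Vu: "verts ?Hu = verts H"
    by (simp_all add: edge_lower_def edge_upper_def)
  have finl: "finite_loop_graph ?Hl" by (rule finite_edge_lower[OF H reg])
  have finu: "finite_loop_graph ?Hu" by (rule finite_edge_upper[OF H reg])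
  have cl: "contracts H x y ?Hl" by (rule contracts_edge_lower[OF H D(1)])
  have cu: "contracts H x y ?Hu" by (rule contracts_edge_upper[OF D(1,4)])
  let ?q = "var_series H x"
  have qy: "var_series H y = ?q" using D(3,4) by (simp add: var_series_def)
  have qX: "?q * (1 - fps_X) = fps_X" by (rule var_series_no_loop[OF D(3)])
  have wl: "var_series ?Hl x = fps_X"
    by (rule var_series_loop) (use edge_lower_loop[OF H reg] in simp)
  have wu: "var_series ?Hu x = ?q" "var_series ?Hu y = ?q"
    using edge_upper_loops[OF reg] D(3) by (simp_all add: var_series_def)
  have xy_u: "{x, y} \<in> edges ?Hu" by (simp add: edge_upper_edges)
  let ?P = "\<lambda>B. \<Prod>v\<in>B. var_series H v"
  let ?fx = "\<lambda>B. \<forall>b\<in>B. {x, b} \<notin> edges H" and ?fy = "\<lambda>B. \<forall>b\<in>B. {y, b} \<notin> edges H"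
  have free_x: "(\<forall>b\<in>B. {x, b} \<notin> edges K) \<longleftrightarrow> ?fx B \<and> ?fy B"
    if "contracts H x y K" "B \<in> ?I" for K B
  proof -
    have "{x, b} \<in> edges K \<longleftrightarrow> {x, b} \<in> edges H \<or> {y, b} \<in> edges H" if "b \<in> B" for b
      by (rule contractsD(1)[OF \<open>contracts H x y K\<close>]) (use that \<open>B \<in> ?I\<close> in auto)
    then show ?thesis by blast
  qed
  have free_y: "\<forall>b\<in>B. {y, b} \<notin> edges ?Hu" if "B \<in> ?I" for B
  proof
    fix b assume "b \<in> B"
    then have "b \<noteq> x" "b \<noteq> y" using that by auto
    then show "{y, b} \<notin> edges ?Hu" by (rule contractsD(2)[OF cu _ _ D(1)])
  qed
  have HS: "hilbert_series (verts H) (edge_ideal H :: ('v, 'k) mpoly set)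
    = (\<Sum>B\<in>?I. ?P B * (1 + (if ?fx B then ?q else 0) + (if ?fy B then ?q else 0)))"
    unfolding hilbert_series_edge_ideal[OF H]
    using sum_semi_indep_split[OF V xV(1) D(1), of "var_series H"] D(2) xV qy by (simp cong: if_cong)
  have "hilbert_series (verts ?Hl) (edge_ideal ?Hl :: ('v, 'k) mpoly set)
    = (\<Sum>B\<in>{B \<in> semi_indep ?Hl. x \<notin> B \<and> y \<notin> B}. (\<Prod>v\<in>B. var_series ?Hl v) *
        (1 + (if \<forall>b\<in>B. {x, b} \<notin> edges ?Hl then fps_X else 0)))"
    unfolding hilbert_series_edge_ideal[OF finl]
    using sum_semi_indep_split[of ?Hl x y "var_series ?Hl"] V xV D(1) wl by (simp add: Vl cong: if_cong)
  also have "\<dots> = (\<Sum>B\<in>?I. ?P B * (1 + (if ?fx B \<and> ?fy B then fps_X else 0)))"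
    using semi_indep_contracts[OF cl] free_x[OF cl] by (intro sum.cong) (auto simp: Vl)
  also have "\<dots> = (\<Sum>B\<in>?I. ?P B * (1 + (if ?fx B then ?q else 0) + (if ?fy B then ?q else 0)) * (1 - fps_X))"
  proof (rule sum.cong[OF refl])
    fix B assume "B \<in> ?I"
    then have "?fx B \<or> ?fy B" using semi_indep_free[OF reg] by blast
    moreover have "(1 + ?q) * (1 - fps_X) = 1" "(1 + ?q + ?q) * (1 - fps_X) = 1 + fps_X"
      using qX by (simp_all add: distrib_right)
    ultimately have "1 + (if ?fx B \<and> ?fy B then fps_X else 0)
      = (1 + (if ?fx B then ?q else 0) + (if ?fy B then ?q else 0)) * (1 - fps_X)"
      by (cases "?fx B"; cases "?fy B") simp_all
    then show "?P B * (1 + (if ?fx B \<and> ?fy B then fps_X else 0))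
      = ?P B * (1 + (if ?fx B then ?q else 0) + (if ?fy B then ?q else 0)) * (1 - fps_X)"
      by (simp only: mult.assoc)
  qed
  finally show ?lower unfolding HS sum_distrib_right .
  have "hilbert_series (verts ?Hu) (edge_ideal ?Hu :: ('v, 'k) mpoly set)
    = (\<Sum>B\<in>{B \<in> semi_indep ?Hu. x \<notin> B \<and> y \<notin> B}. (\<Prod>v\<in>B. var_series ?Hu v) *
        (1 + (if \<forall>b\<in>B. {x, b} \<notin> edges ?Hu then ?q else 0) + (if \<forall>b\<in>B. {y, b} \<notin> edges ?Hu then ?q else 0)))"
    unfolding hilbert_series_edge_ideal[OF finu]
    using sum_semi_indep_split[of ?Hu x y "var_series ?Hu"] V xV D(1) wu xy_u by (simp add: Vu cong: if_cong)
  also have "\<dots> = (\<Sum>B\<in>?I. ?P B * (1 + (if ?fx B \<and> ?fy B then ?q else 0) + ?q))"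
    using semi_indep_contracts[OF cu] free_x[OF cu] free_y by (intro sum.cong) (auto simp: Vu)
  also have "\<dots> = (\<Sum>B\<in>?I. ?P B * (1 + (if ?fx B then ?q else 0) + (if ?fy B then ?q else 0)))"
  proof (rule sum.cong[OF refl])
    fix B assume "B \<in> ?I"
    then have "?fx B \<or> ?fy B" using semi_indep_free[OF reg] by blast
    then show "?P B * (1 + (if ?fx B \<and> ?fy B then ?q else 0) + ?q)
      = ?P B * (1 + (if ?fx B then ?q else 0) + (if ?fy B then ?q else 0))"
      by (cases "?fx B"; cases "?fy B") simp_all
  qed
  finally show ?upper unfolding HS .
qed

lemma indep_number_eqI:
  assumes "finite (verts H)" "A \<in> indep_sets H" "card A = n" "\<And>A. A \<in> indep_sets H \<Longrightarrow> card A \<le> n"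
  shows "indep_number H = n"
  using indep_number(2,3)[OF assms(1)] assms(2-4) by (metis le_antisym)

text \<open>Here \<open>L\<close> plays the role of the lower contraction, and \<open>H\<close> is either the given graph or its upper
contraction: independent sets of \<open>L\<close> avoid \<open>x\<close> and \<open>y\<close>, and those of \<open>H\<close> contain at most one of them.\<close>

lemma indep_number_Suc:
  assumes V: "finite (verts H)" and VL: "verts L = verts H - {y}" and xy: "x \<noteq> y" "{x, y} \<in> edges H"
    and loop: "{x, x} \<in> edges L"
    and e: "\<And>a b. a \<notin> {x, y} \<Longrightarrow> b \<notin> {x, y} \<Longrightarrow> {a, b} \<in> edges L \<longleftrightarrow> {a, b} \<in> edges H"
    and extend: "\<And>B. B \<in> indep_sets L \<Longrightarrow> \<exists>z\<in>{x, y}. insert z B \<in> indep_sets H"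
  shows "indep_number H = Suc (indep_number L)"
proof -
  have VfL: "finite (verts L)" using V VL by simp
  have off: "x \<notin> B" "y \<notin> B" if "B \<in> indep_sets L" for B
    using that loop VL unfolding indep_sets_def by blast+
  obtain B where B: "B \<in> indep_sets L" "card B = indep_number L"
    using indep_number(3)[OF VfL] by blast
  obtain z where z: "z \<in> {x, y}" "insert z B \<in> indep_sets H" using extend[OF B(1)] by blast
  have "finite B" using B(1) VfL finite_subset unfolding indep_sets_def by blast
  then have card: "card (insert z B) = Suc (indep_number L)"
    using z(1) off[OF B(1)] B(2) by auto
  have le: "card A \<le> Suc (indep_number L)" if A: "A \<in> indep_sets H" for A
  proof -
    have finA: "finite A" using A V finite_subset unfolding indep_sets_def by blast
    have "A - {x, y} \<in> indep_sets L"
      using A e VL unfolding indep_sets_def by blast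
    then have "card (A - {x, y}) \<le> indep_number L" by (rule indep_number(2)[OF VfL])
    moreover have "\<not> (x \<in> A \<and> y \<in> A)" using A xy(2) unfolding indep_sets_def by blast
    then have "\<exists>z. A \<subseteq> insert z (A - {x, y})" by blast
    then obtain z where "A \<subseteq> insert z (A - {x, y})" by blast
    then have "card A \<le> Suc (card (A - {x, y}))"
      using card_mono[of "insert z (A - {x, y})" A] card_insert_le_m1 finA
      by (metis card.insert finite_Diff finite_insert insert_absorb le_SucI)
    ultimately show ?thesis by simp
  qed
  show ?thesis by (rule indep_number_eqI[OF V z(2) card le])
qed

text \<open>An independent set without \<open>x\<close> and \<open>y\<close> extends by \<open>x\<close> or \<open>y\<close> in \<open>H\<close>, because the
neighbours of \<open>x\<close> are adjacent to those of \<open>y\<close>, and always by \<open>y\<close> in the upper contraction, where \<open>x\<close> is the only neighbour of \<open>y\<close>.\<close>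

lemma indep_number_regular_edge:
  fixes H :: "'v loop_graph"
  assumes H: "finite_loop_graph H" and reg: "regular_pair H x y"
  shows "indep_number H = Suc (indep_number (edge_lower H x y))"
    and "indep_number (edge_upper H x y) = indep_number H"
proof -
  let ?Hl = "edge_lower H x y" and ?Hu = "edge_upper H x y"
  note D = regular_pairD[OF reg]
  have V: "finite (verts H)" using H by (simp add: finite_loop_graph_def)
  have xV: "x \<in> verts H" "y \<in> verts H" using edge_in_verts[OF H D(2)] by blast+
  have Vl: "verts ?Hl = verts H - {y}" and Vu: "verts ?Hu = verts H"
    by (simp_all add: edge_lower_def edge_upper_def)
  have cl: "contracts H x y ?Hl" by (rule contracts_edge_lower[OF H D(1)])
  have cu: "contracts H x y ?Hu" by (rule contracts_edge_upper[OF D(1,4)])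
  have loop: "{x, x} \<in> edges ?Hl" by (rule edge_lower_loop[OF H reg])
  have off: "x \<notin> B" "y \<notin> B" "B \<subseteq> verts H" if "B \<in> indep_sets ?Hl" for B
    using that loop Vl unfolding indep_sets_def by blast+
  have el: "{a, b} \<in> edges ?Hl \<longleftrightarrow> {a, b} \<in> edges H" if "a \<notin> {x, y}" "b \<notin> {x, y}" for a b
    using contractsD(3)[OF cl] that by simp
  have eu: "{a, b} \<in> edges ?Hu \<longleftrightarrow> {a, b} \<in> edges H" if "a \<notin> {x, y}" "b \<notin> {x, y}" for a b
    using contractsD(3)[OF cu] that by simp
  have indep: "{u, v} \<notin> edges H" if B: "B \<in> indep_sets ?Hl" and uv: "u \<in> B" "v \<in> B" for B u v
  proof -
    have "u \<notin> {x, y}" "v \<notin> {x, y}" using off[OF B] uv by auto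
    then show ?thesis using el B uv unfolding indep_sets_def by blast
  qed
  have insert_indep: "insert z B \<in> indep_sets K"
    if "z \<in> verts K" "B \<subseteq> verts K" "{z} \<notin> edges K" "\<And>b. b \<in> B \<Longrightarrow> {z, b} \<notin> edges K"
      "\<And>u v. u \<in> B \<Longrightarrow> v \<in> B \<Longrightarrow> {u, v} \<notin> edges K" for z B and K :: "'v loop_graph"
    using that unfolding indep_sets_def by (auto simp: insert_commute)
  show 1: "indep_number H = Suc (indep_number ?Hl)"
  proof (rule indep_number_Suc[OF V Vl D(1,2) loop el])
    fix B assume B: "B \<in> indep_sets ?Hl"
    have "B \<in> semi_indep H" using off(3)[OF B] indep[OF B] unfolding semi_indep_def by blast
    then consider "\<forall>b\<in>B. {x, b} \<notin> edges H" | "\<forall>b\<in>B. {y, b} \<notin> edges H"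
      using semi_indep_free[OF reg] by blast
    then show "\<exists>z\<in>{x, y}. insert z B \<in> indep_sets H"
    proof cases
      case 1
      then have "insert x B \<in> indep_sets H"
        using insert_indep[OF xV(1) off(3)[OF B] D(3)] indep[OF B] by blast
      then show ?thesis by blast
    next
      case 2
      then have "insert y B \<in> indep_sets H"
        using insert_indep[OF xV(2) off(3)[OF B] D(4)] indep[OF B] by blast
      then show ?thesis by blast
    qed
  qed
  have "indep_number ?Hu = Suc (indep_number ?Hl)"
  proof (rule indep_number_Suc[where x = x and y = y])
    show "finite (verts ?Hu)" "verts ?Hl = verts ?Hu - {y}" using V Vl Vu by simp_all
    show "x \<noteq> y" "{x, x} \<in> edges ?Hl" by (rule D(1), rule loop)
    show "{x, y} \<in> edges ?Hu" by (simp add: edge_upper_edges)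
    show "{a, b} \<in> edges ?Hl \<longleftrightarrow> {a, b} \<in> edges ?Hu" if "a \<notin> {x, y}" "b \<notin> {x, y}" for a b
      using el[OF that] eu[OF that] by simp
    fix B assume B: "B \<in> indep_sets ?Hl"
    have "insert y B \<in> indep_sets ?Hu"
    proof (rule insert_indep)
      show "y \<in> verts ?Hu" "B \<subseteq> verts ?Hu" using xV off(3)[OF B] Vu by simp_all
      show "{y} \<notin> edges ?Hu" by (rule edge_upper_loops[OF reg])
      show "{y, b} \<notin> edges ?Hu" if "b \<in> B" for b
        by (rule contractsD(2)[OF cu _ _ D(1)]) (use off[OF B] that in auto)
      show "{u, v} \<notin> edges ?Hu" if uv: "u \<in> B" "v \<in> B" for u v
      proof -
        have "u \<notin> {x, y}" "v \<notin> {x, y}" using off[OF B] uv by auto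
        then show ?thesis using eu indep[OF B uv] by blast
      qed
    qed
    then show "\<exists>z\<in>{x, y}. insert z B \<in> indep_sets ?Hu" by blast
  qed
  then show "indep_number ?Hu = indep_number H" using 1 by simp
qed

section \<open>Iterated contraction\<close>

text \<open>The condition that one end of the \<open>i\<close>-th edge avoids all earlier edges is part of the invariant: it is
what keeps the later edges regular, and it persists because the neighbours of that end do not change.\<close>

lemma iterated_contraction_regular:
  fixes F :: "'v loop_graph \<Rightarrow> 'v \<Rightarrow> 'v \<Rightarrow> 'v loop_graph"
  assumes step: "\<And>H u v. finite_loop_graph H \<Longrightarrow> regular_pair H u v \<Longrightarrow>
      finite_loop_graph (F H u v) \<and> contracts H u v (F H u v)"
    and G: "finite_loop_graph G"
    and reg: "\<And>i. 1 \<le> i \<Longrightarrow> i \<le> t \<Longrightarrow> regular_pair G (x i) (y i)"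
    and disjoint: "\<And>i j. 1 \<le> i \<Longrightarrow> i < j \<Longrightarrow> j \<le> t \<Longrightarrow> {x i, y i} \<inter> {x j, y j} = {}"
    and nbrs: "\<And>i. 1 \<le> i \<Longrightarrow> i \<le> t \<Longrightarrow>
        nbrs G (x i) \<inter> (x ` {1..<i} \<union> y ` {1..<i}) = {}
      \<or> nbrs G (y i) \<inter> (x ` {1..<i} \<union> y ` {1..<i}) = {}"
  defines "H \<equiv> \<lambda>k. fold (\<lambda>i H. F H (x i) (y i)) [1..<Suc k] G"
  shows "k \<le> t \<Longrightarrow> finite_loop_graph (H k) \<and>
    (\<forall>i. k < i \<and> i \<le> t \<longrightarrow> regular_pair (H k) (x i) (y i) \<and>
      (nbrs (H k) (x i) \<inter> (x ` {1..<i} \<union> y ` {1..<i}) = {}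
      \<or> nbrs (H k) (y i) \<inter> (x ` {1..<i} \<union> y ` {1..<i}) = {}))"
proof (induction k)
  case 0
  then show ?case using G reg nbrs by (simp add: H_def)
next
  case (Suc k)
  let ?K = "F (H k) (x (Suc k)) (y (Suc k))"
  have HSuc: "H (Suc k) = ?K" by (simp add: H_def)
  have IH: "finite_loop_graph (H k)"
    "\<And>i. k < i \<Longrightarrow> i \<le> t \<Longrightarrow> regular_pair (H k) (x i) (y i)"
    "\<And>i. k < i \<Longrightarrow> i \<le> t \<Longrightarrow> nbrs (H k) (x i) \<inter> (x ` {1..<i} \<union> y ` {1..<i}) = {}
      \<or> nbrs (H k) (y i) \<inter> (x ` {1..<i} \<union> y ` {1..<i}) = {}"
    using Suc.IH Suc.prems by auto
  have reg_k: "regular_pair (H k) (x (Suc k)) (y (Suc k))" using IH(2) Suc.prems by simp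
  note xy = regular_pairD(1)[OF reg_k]
  have K: "finite_loop_graph ?K" "contracts (H k) (x (Suc k)) (y (Suc k)) ?K"
    using step[OF IH(1) reg_k] by blast+
  have "regular_pair ?K (x i) (y i) \<and>
      (nbrs ?K (x i) \<inter> (x ` {1..<i} \<union> y ` {1..<i}) = {}
      \<or> nbrs ?K (y i) \<inter> (x ` {1..<i} \<union> y ` {1..<i}) = {})" if i: "Suc k < i" "i \<le> t" for i
  proof -
    have disj: "{x (Suc k), y (Suc k)} \<inter> {x i, y i} = {}" using disjoint[of "Suc k" i] i by simp
    have sub: "{x (Suc k), y (Suc k)} \<subseteq> x ` {1..<i} \<union> y ` {1..<i}" using i by auto
    have reg_i: "regular_pair (H k) (x i) (y i)" using IH(2) i by simp
    from IH(3)[of i] i consider "nbrs (H k) (x i) \<inter> (x ` {1..<i} \<union> y ` {1..<i}) = {}"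
      | "nbrs (H k) (y i) \<inter> (x ` {1..<i} \<union> y ` {1..<i}) = {}" by linarith
    then show ?thesis
    proof cases
      case 1
      have "regular_pair (H k) (y i) (x i)" using reg_i regular_pair_commute by metis
      moreover have "{x (Suc k), y (Suc k)} \<inter> {y i, x i} = {}" using disj by blast
      moreover have "nbrs (H k) (x i) \<inter> {x (Suc k), y (Suc k)} = {}" using 1 sub by blast
      ultimately have "regular_pair ?K (y i) (x i)" "nbrs ?K (x i) = nbrs (H k) (x i)"
        by (rule regular_pair_contracts[OF K(2) xy])+
      then show ?thesis using 1 regular_pair_commute by metis
    next
      case 2
      have "nbrs (H k) (y i) \<inter> {x (Suc k), y (Suc k)} = {}" using 2 sub by blast
      then have "regular_pair ?K (x i) (y i)" "nbrs ?K (y i) = nbrs (H k) (y i)"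
        by (rule regular_pair_contracts[OF K(2) xy reg_i disj])+
      then show ?thesis using 2 by simp
    qed
  qed
  then show ?case using K(1) unfolding HSuc by blast
qed

text \<open>Multiplying the series by \<open>(1 - t)\<^sup>k\<close> while lowering the dimension by \<open>k\<close> keeps the numerator.\<close>

lemma same_h_vectorI:
  fixes G H :: "'v loop_graph"
  assumes G: "finite_loop_graph G" and H: "finite_loop_graph H"
    and d: "indep_number G = k + indep_number H"
    and hs: "hilbert_series (verts H) (edge_ideal H :: ('v, 'k::field) mpoly set)
      = hilbert_series (verts G) (edge_ideal G :: ('v, 'k) mpoly set) * (1 - fps_X) ^ k"
  shows "same_h_vector (verts H) (edge_ideal H :: ('v, 'k) mpoly set) (verts G) (edge_ideal G)"
proof -
  obtain h where h: "hilbert_series (verts G) (edge_ideal G :: ('v, 'k) mpoly set) * (1 - fps_X) ^ indep_number G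
    = fps_of_poly h" using h_polynomial_exists[OF G] by blast
  have "is_h_polynomial (verts G) (edge_ideal G :: ('v, 'k) mpoly set) h"
    unfolding is_h_polynomial_def using h krull_dim_edge_ideal[OF G] by blast
  moreover have "hilbert_series (verts H) (edge_ideal H :: ('v, 'k) mpoly set) * (1 - fps_X) ^ indep_number H
    = fps_of_poly h"
    using h unfolding hs d by (simp add: power_add mult.assoc)
  then have "is_h_polynomial (verts H) (edge_ideal H :: ('v, 'k) mpoly set) h"
    unfolding is_h_polynomial_def using krull_dim_edge_ideal[OF H] by blast
  ultimately show ?thesis unfolding same_h_vector_def by blast
qed

theorem proposition7p3:
  fixes G :: "'v loop_graph" and x y :: "nat \<Rightarrow> 'v" and t :: nat
  assumes graph: "finite_loop_graph G"
    and regular: "\<And>i. 1 \<le> i \<Longrightarrow> i \<le> t \<Longrightarrow> regular_edge TYPE('k::field) G (x i) (y i)"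
    and disjoint: "\<And>i j. 1 \<le> i \<Longrightarrow> i < j \<Longrightarrow> j \<le> t \<Longrightarrow> {x i, y i} \<inter> {x j, y j} = {}"
    and nbrs: "\<And>i. 2 \<le> i \<Longrightarrow> i \<le> t \<Longrightarrow>
        nbrs G (x i) \<inter> (x ` {1..<i} \<union> y ` {1..<i} \<union> loop_verts G) = {}
      \<or> nbrs G (y i) \<inter> (x ` {1..<i} \<union> y ` {1..<i} \<union> loop_verts G) = {}"
  shows "same_h_vector
           (verts (iter_lower G x y t)) (edge_ideal (iter_lower G x y t) :: ('v, 'k) mpoly set)
           (verts G) (edge_ideal G)
       \<and> same_h_vector
           (verts (iter_upper G x y t)) (edge_ideal (iter_upper G x y t) :: ('v, 'k) mpoly set)
           (verts G) (edge_ideal G)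
       \<and> hilbert_series (verts G) (edge_ideal G :: ('v, 'k) mpoly set)
         = hilbert_series
             (verts (iter_upper G x y t)) (edge_ideal (iter_upper G x y t) :: ('v, 'k) mpoly set)"
proof -
  have reg: "regular_pair G (x i) (y i)" if "1 \<le> i" "i \<le> t" for i
    using regular_edge_imp_regular_pair[OF graph regular[OF that]] .
  have nb: "nbrs G (x i) \<inter> (x ` {1..<i} \<union> y ` {1..<i}) = {}
      \<or> nbrs G (y i) \<inter> (x ` {1..<i} \<union> y ` {1..<i}) = {}" if i: "1 \<le> i" "i \<le> t" for i
  proof (cases "2 \<le> i")
    case True
    then show ?thesis using nbrs[OF True i(2)] by blast
  next
    case False
    \<comment> \<open>the first edge has no earlier edges to avoid\<close>
    then have "i = 1" using i by simp
    then show ?thesis by simp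
  qed
  let ?HS = "\<lambda>H. hilbert_series (verts H) (edge_ideal H :: ('v, 'k) mpoly set)"
  have step_lower: "finite_loop_graph (edge_lower H u v) \<and> contracts H u v (edge_lower H u v)"
    if "finite_loop_graph H" "regular_pair H u v" for H :: "'v loop_graph" and u v
    using finite_edge_lower[OF that] contracts_edge_lower[OF that(1) regular_pairD(1)[OF that(2)]] by blast
  have step_upper: "finite_loop_graph (edge_upper H u v) \<and> contracts H u v (edge_upper H u v)"
    if "finite_loop_graph H" "regular_pair H u v" for H :: "'v loop_graph" and u v
    using finite_edge_upper[OF that] contracts_edge_upper[OF regular_pairD(1,4)[OF that(2)]] by blast
  have inv_lower: "finite_loop_graph (iter_lower G x y k)"
    "k < i \<Longrightarrow> i \<le> t \<Longrightarrow> regular_pair (iter_lower G x y k) (x i) (y i)" if "k \<le> t" for k i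
    using iterated_contraction_regular[where F = edge_lower and x = x and y = y,
        OF step_lower graph reg disjoint nb that]
    unfolding iter_lower_def[symmetric] by blast+
  have inv_upper: "finite_loop_graph (iter_upper G x y k)"
    "k < i \<Longrightarrow> i \<le> t \<Longrightarrow> regular_pair (iter_upper G x y k) (x i) (y i)" if "k \<le> t" for k i
    using iterated_contraction_regular[where F = edge_upper and x = x and y = y,
        OF step_upper graph reg disjoint nb that]
    unfolding iter_upper_def[symmetric] by blast+
  have Suc_lower: "iter_lower G x y (Suc k) = edge_lower (iter_lower G x y k) (x (Suc k)) (y (Suc k))" for k
    by (simp add: iter_lower_def)
  have Suc_upper: "iter_upper G x y (Suc k) = edge_upper (iter_upper G x y k) (x (Suc k)) (y (Suc k))" for k
    by (simp add: iter_upper_def)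
  have lower: "?HS (iter_lower G x y k) = ?HS G * (1 - fps_X) ^ k
      \<and> indep_number G = k + indep_number (iter_lower G x y k)" if "k \<le> t" for k
    using that
  proof (induction k)
    case 0
    then show ?case by (simp add: iter_lower_def)
  next
    case (Suc k)
    have fin: "finite_loop_graph (iter_lower G x y k)" using inv_lower(1) Suc.prems by simp
    have reg_k: "regular_pair (iter_lower G x y k) (x (Suc k)) (y (Suc k))"
      using inv_lower(2) Suc.prems by simp
    show ?case
      using Suc.IH Suc.prems hilbert_series_regular_edge(1)[OF fin reg_k, where 'k = 'k]
        indep_number_regular_edge(1)[OF fin reg_k]
      unfolding Suc_lower by (simp add: mult_ac)
  qed
  have upper: "?HS (iter_upper G x y k) = ?HS G
      \<and> indep_number G = indep_number (iter_upper G x y k)" if "k \<le> t" for k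
    using that
  proof (induction k)
    case 0
    then show ?case by (simp add: iter_upper_def)
  next
    case (Suc k)
    have fin: "finite_loop_graph (iter_upper G x y k)" using inv_upper(1) Suc.prems by simp
    have reg_k: "regular_pair (iter_upper G x y k) (x (Suc k)) (y (Suc k))"
      using inv_upper(2) Suc.prems by simp
    show ?case
      using Suc.IH Suc.prems hilbert_series_regular_edge(2)[OF fin reg_k, where 'k = 'k]
        indep_number_regular_edge(2)[OF fin reg_k]
      unfolding Suc_upper by simp
  qed
  have "same_h_vector (verts (iter_lower G x y t)) (edge_ideal (iter_lower G x y t) :: ('v, 'k) mpoly set)
      (verts G) (edge_ideal G)"
    using same_h_vectorI[OF graph inv_lower(1)[OF order_refl]] lower[OF order_refl] by blast
  moreover have "same_h_vector (verts (iter_upper G x y t)) (edge_ideal (iter_upper G x y t) :: ('v, 'k) mpoly set)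
      (verts G) (edge_ideal G)"
    by (rule same_h_vectorI[OF graph inv_upper(1)[OF order_refl], of 0])
      (use upper[OF order_refl] in simp_all)
  ultimately show ?thesis using upper[OF order_refl] by simp
qed

end
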